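(* Let $\mathcal{L}$ be a finite atomic meet-semilattice, and let $\mathcal{G}$, $\mathcal{H}$ be building sets in $\mathcal{L}$ with $\mathcal{G}\supseteq\mathcal{H}$. Then the fan $\Sigma(\mathcal{L},\mathcal{G})$ is obtained from $\Sigma(\mathcal{L},\mathcal{H})$ by a sequence of stellar subdivisions. In particular, the supports of the fans $\Sigma(\mathcal{L},\mathcal{G})$ and $\Sigma(\mathcal{L},\mathcal{H})$ coincide.
   Context: All posets are finite. A meet-semilattice is a poset in which greatest lower bounds exist for any subset of elements; a finite meet-semilattice $\mathcal{L}$ has a minimal element, denoted $\hat 0$, and $\mathcal{L}_{>\hat 0}:=\mathcal{L}\setminus\{\hat 0\}$. Atoms are the minimal elements of $\mathcal{L}_{>\hat 0}$; $\mathcal{L}$ is atomic if every element is the join of the atoms below it ($\hat 0$ being the empty join). For $X,Y\in\mathcal{L}$, $[X,Y]:=\{Z\in\mathcal{L}\mid X\le Z\le Y\}$. For $\mathcal{S}\subseteq\mathcal{L}$, $\max\mathcal{S}$ is the set of maximal elements of $\mathcal{S}$, and $\mathcal{S}_{\le X}:=\{Y\in\mathcal{S}\mid Y\le X\}$. Joins ($\vee$) are least upper bounds in $\mathcal{L}$, when they exist. Building set: a subset $\mathcal{G}\subseteq\mathcal{L}_{>\hat 0}$ is a building set in $\mathcal{L}$ if for every $X\in\mathcal{L}_{>\hat 0}$, writing $\max\mathcal{G}_{\le X}=\{G_1,\dots,G_k\}$, there is an isomorphism of posets \[ \varphi_X:\ \prod_{j=1}^k[\hat 0,G_j]\ \xrightarrow{\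 \cong\ }\ [\hat 0,X] \] with $\varphi_X(\hat 0,\dots,G_j,\dots,\hat 0)=G_j$ for $j=1,\dots,k$ (where $G_j$ stands in the $j$-th coordinate). Nested sets: given a building set $\mathcal{G}$ in $\mathcal{L}$, a subset $\mathcal{S}\subseteq\mathcal{G}$ is called nested (or $\mathcal{G}$-nested) if for any set of pairwise incomparable elements $X_1,\dots,X_t$ in $\mathcal{S}$ with $t\ge 2$, the join $X_1\vee\dots\vee X_t$ exists in $\mathcal{L}$ and does not belong to $\mathcal{G}$. The $\mathcal{G}$-nested sets form an abstract simplicial complex $\mathcal{N}(\mathcal{L},\mathcal{G})$ on the vertex set $\mathcal{G}$, the nested set complex. The fan: let $\{A_1,\dots,A_n\}$ be the set of atoms of $\mathcal{L}$. For $X\in\mathcal{L}$ define the characteristic vector $v_X\in\mathbb{R}^n$ by $(v_X)_i=1$ if $A_i\le X$ and $(v_X)_i=0$ otherwise. For $\mathcal{S}\subseteq\mathcal{L}$ let $V(\mathcal{S})$ be the cone in $\mathbb{R}^n$ spanned by the vectors $v_X$, $X\in\mathcal{S}$ (with $V(\emptyset)=\{0\}$). For a building set $\mathcal{G}$ in $\mathcal{L}$, \[ \Sigma(\mathcal{L},\mathcal{G}):=\{V(\mathcal{S})\mid \mathcal{S}\in\mathcal{N}(\mathcal{L},\mathcal{G})\}. \] It is known that this is a rational simplicial polyhedral fan in $\mathbb{R}^n$, whose face poset coincides with the face poset of $\mathcal{N}(\mathcal{L},\mathcal{G})$; its rays are in bijection with the elements of $\mathcal{G}$. The support of a fan is the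 union of its cones. The stellar subdivision of a simplicial fan $\Sigma$ in a cone $\sigma\in\Sigma$, with new ray generated by a vector $v$ in the relative interior of $\sigma$, is the fan obtained from $\Sigma$ by removing all cones that contain $\sigma$ as a face and adding all cones $\rho+\mathbb{R}_{\ge 0}v$, where $\rho\in\Sigma$ does not contain $\sigma$ as a face but $\rho$ is a face of some cone $\tau\in\Sigma$ having $\sigma$ as a face. A sequence of stellar subdivisions is finite and may be empty (when $\mathcal{G}=\mathcal{H}$). *)

theory Defs
  imports "HOL-Analysis.Analysis" "HOL-Library.Lub_Glb"
begin

section \<open>Semilattices, building sets and nested sets\<close>

text \<open>
  A finite meet-semilattice is a type of sort \<open>{finite, semilattice_inf, order_bot}\<close>.  Joins need
  not exist, so they are expressed by the relation \<^const>\<open>isLub\<close>.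
\<close>

definition atoms :: "'a::order_bot set" where
  "atoms = {a. a \<noteq> bot \<and> (\<forall>b. b \<noteq> bot \<and> b \<le> a \<longrightarrow> b = a)}"

definition maximals :: "'a::order set \<Rightarrow> 'a set" where
  "maximals S = {x \<in> S. \<forall>y\<in>S. x \<le> y \<longrightarrow> y = x}"

text \<open>
  An element of the product of the intervals below the \<open>G\<^sub>j\<close> is an extensional function on the
  index set \<open>M = {G\<^sub>1, \<dots>, G\<^sub>k}\<close>; the product order is the pointwise order on \<open>M\<close>.
\<close>

definition building_set :: "'a::order_bot set \<Rightarrow> bool" where
  "building_set G \<longleftrightarrow> bot \<notin> G \<and>
    (\<forall>X. X \<noteq> bot \<longrightarrow>
      (let M = maximals {Y \<in> G. Y \<le> X}; P = (\<Pi>\<^sub>E j\<in>M. {bot..j}) in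
        \<exists>\<phi>. bij_betw \<phi> P {bot..X} \<and>
            (\<forall>f\<in>P. \<forall>g\<in>P. \<phi> f \<le> \<phi> g \<longleftrightarrow> (\<forall>j\<in>M. f j \<le> g j)) \<and>
            (\<forall>i\<in>M. \<phi> (\<lambda>j\<in>M. if j = i then i else bot) = i)))"

definition nested :: "'a::order set \<Rightarrow> 'a set \<Rightarrow> bool" where
  "nested G S \<longleftrightarrow> S \<subseteq> G \<and>
    (\<forall>T. T \<subseteq> S \<and> finite T \<and> card T \<ge> 2 \<and> pairwise (\<lambda>x y. \<not> x \<le> y) T \<longrightarrow>
      (\<exists>J. isLub UNIV T J \<and> J \<notin> G))"

definition nested_complex :: "'a::order set \<Rightarrow> 'a set set" where
  "nested_complex G = {S. nested G S}"


section \<open>The fan of a building set\<close>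

text \<open>
  The atoms are enumerated by a bijection \<open>A\<close> from a subset \<open>I\<close> of a finite type \<open>'n\<close>.
  With \<open>I = UNIV\<close> the ambient space is \<open>\<real>\<^sup>n\<close> for \<open>n\<close> the number of atoms; otherwise \<open>\<real>\<^sup>n\<close> is the
  subspace of the coordinates in \<open>I\<close>.  The freedom in \<open>I\<close> is there because types are
  nonempty: the one-element semilattice has \<open>n = 0\<close>, so \<open>I = {}\<close>.
\<close>

definition char_vec :: "'n set \<Rightarrow> ('n \<Rightarrow> 'a::order) \<Rightarrow> 'a \<Rightarrow> real ^ 'n" where
  "char_vec I A X = (\<chi> i. if i \<in> I \<and> A i \<le> X then 1 else 0)"

definition cone_of :: "'n::finite set \<Rightarrow> ('n \<Rightarrow> 'a::order) \<Rightarrow> 'a set \<Rightarrow> (real ^ 'n) set" where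
  "cone_of I A S = convex_cone hull (char_vec I A ` S)"

definition nested_fan :: "'n::finite set \<Rightarrow> ('n \<Rightarrow> 'a::order) \<Rightarrow> 'a set \<Rightarrow> (real ^ 'n) set set" where
  "nested_fan I A G = cone_of I A ` nested_complex G"


section \<open>Stellar subdivisions of simplicial fans\<close>

definition simplicial_cone :: "'v::euclidean_space set \<Rightarrow> bool" where
  "simplicial_cone C \<longleftrightarrow> (\<exists>B. independent B \<and> C = convex_cone hull B)"

text \<open>The empty set is a face in the sense of \<^const>\<open>face_of\<close>, but not a cone of a fan.\<close>

definition simplicial_fan :: "'v::euclidean_space set set \<Rightarrow> bool" where
  "simplicial_fan \<Sigma> \<longleftrightarrow> finite \<Sigma> \<and> \<Sigma> \<noteq> {} \<and>
    (\<forall>\<sigma>\<in>\<Sigma>. simplicial_cone \<sigma>) \<and>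
    (\<forall>\<sigma>\<in>\<Sigma>. \<forall>\<tau>. \<tau> face_of \<sigma> \<and> \<tau> \<noteq> {} \<longrightarrow> \<tau> \<in> \<Sigma>) \<and>
    (\<forall>\<sigma>\<in>\<Sigma>. \<forall>\<tau>\<in>\<Sigma>. (\<sigma> \<inter> \<tau>) face_of \<sigma> \<and> (\<sigma> \<inter> \<tau>) face_of \<tau>)"

definition stellar :: "'v::euclidean_space set set \<Rightarrow> 'v set \<Rightarrow> 'v \<Rightarrow> 'v set set" where
  "stellar \<Sigma> \<sigma> v =
    {\<rho> \<in> \<Sigma>. \<not> \<sigma> face_of \<rho>} \<union>
    {{x + c *\<^sub>R v | x c. x \<in> \<rho> \<and> 0 \<le> c} | \<rho>.
       \<rho> \<in> \<Sigma> \<and> \<not> \<sigma> face_of \<rho> \<and> (\<exists>\<tau>\<in>\<Sigma>. \<sigma> face_of \<tau> \<and> \<rho> face_of \<tau>)}"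

text \<open>
  The condition \<open>v \<noteq> 0\<close> says that \<open>v\<close> generates a ray; it excludes exactly the case that
  \<open>\<sigma>\<close> is the zero cone.
\<close>

definition stellar_subdivision ::
    "'v::euclidean_space set set \<Rightarrow> 'v set set \<Rightarrow> bool" where
  "stellar_subdivision \<Sigma> \<Sigma>' \<longleftrightarrow> simplicial_fan \<Sigma> \<and>
    (\<exists>\<sigma>\<in>\<Sigma>. \<exists>v\<in>rel_interior \<sigma>. v \<noteq> 0 \<and> \<Sigma>' = stellar \<Sigma> \<sigma> v)"

end

theory Submission
  imports Defs
begin

text \<open>
  The elements of \<open>G - H\<close> are removed from \<open>G\<close> one at a time, always a minimal one \<open>X\<close>, so that the
  elements of \<open>G - {X}\<close> below \<open>X\<close> are those of \<open>H\<close>. Then \<open>G - {X}\<close> is again a building set: where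
  \<open>X\<close> is a factor, it is replaced by its own factors \<open>F = max H\<^sub>\<le>\<^sub>X\<close>. The nested set complex of \<open>G\<close>
  is the stellar subdivision of that of \<open>G - {X}\<close> in the simplex \<open>F\<close>, and the characteristic vector
  of \<open>X\<close> is the sum of those of \<open>F\<close>, because an atom below \<open>X\<close> lies below exactly one factor.

  That the cones form a simplicial fan amounts to the statement that a point has at most one
  representation as a positive combination over a nested set \<open>S\<close>. The maximal elements of \<open>S\<close> are
  the factors of their join \<open>J\<close>, and the atoms below \<open>J\<close> are the coordinates in which the point does
  not vanish; so the point determines them. The coefficient of a maximal element \<open>X\<close> is the minimum
  of the coordinates at atoms below \<open>X\<close>. One subtracts it and repeats.
\<close>

section \<open>Fans of cones with unique representations\<close>

definition comb :: "('a::finite \<Rightarrow> 'v::real_vector) \<Rightarrow> ('a \<Rightarrow> real) \<Rightarrow> 'v" where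
  "comb v c = (\<Sum>x\<in>UNIV. c x *\<^sub>R v x)"

lemma comb_add: "comb v (\<lambda>x. c x + d x) = comb v c + comb v d"
  by (simp add: comb_def scaleR_add_left sum.distrib)

lemma comb_diff: "comb v (\<lambda>x. c x - d x) = comb v c - comb v d"
  by (simp add: comb_def scaleR_diff_left sum_subtractf)

lemma comb_scale: "comb v (\<lambda>x. r * c x) = r *\<^sub>R comb v c"
  by (simp add: comb_def scaleR_sum_right)

lemma comb_zero [simp]: "comb v (\<lambda>x. 0) = 0"
  by (simp add: comb_def)

lemma comb_unit: "comb v (\<lambda>y. if y = x then r else 0) = r *\<^sub>R v x"
  by (simp add: comb_def if_distrib [of "\<lambda>r. r *\<^sub>R _"] cong: if_cong)

lemma comb_indicator: "comb v (indicator S) = sum v S"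
  unfolding comb_def by (rule sum.mono_neutral_cong_right) (auto simp: indicator_def)

text \<open>Coefficients are total functions, zero outside \<open>S\<close>. Representations over
  different generating sets can thus be compared, and uniqueness reads \<open>c = d\<close>.\<close>

definition nonneg_on :: "'a set \<Rightarrow> ('a \<Rightarrow> real) set" where
  "nonneg_on S = {c. (\<forall>x. 0 \<le> c x) \<and> (\<forall>x. x \<notin> S \<longrightarrow> c x = 0)}"

lemma nonneg_onD:
  assumes "c \<in> nonneg_on S"
  shows "0 \<le> c x" "x \<notin> S \<Longrightarrow> c x = 0"
  using assms by (auto simp: nonneg_on_def)

lemma nonneg_on_mono: "c \<in> nonneg_on S \<Longrightarrow> S \<subseteq> T \<Longrightarrow> c \<in> nonneg_on T"
  by (auto simp: nonneg_on_def)

lemma convex_cone_hull_eq_comb: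
  fixes v :: "'a::finite \<Rightarrow> 'v::real_vector"
  shows "convex_cone hull (v ` S) = comb v ` nonneg_on S"
proof
  have "convex_cone (comb v ` nonneg_on S)"
    unfolding convex_cone_iff
  proof (intro conjI ballI allI impI)
    show "0 \<in> comb v ` nonneg_on S"
      by (rule image_eqI [where x = "\<lambda>x. 0"]) (auto simp: nonneg_on_def)
    fix p q assume "p \<in> comb v ` nonneg_on S" "q \<in> comb v ` nonneg_on S"
    then obtain c d where cd: "c \<in> nonneg_on S" "p = comb v c" "d \<in> nonneg_on S" "q = comb v d"
      by blast
    then have "(\<lambda>x. c x + d x) \<in> nonneg_on S" by (simp add: nonneg_on_def)
    then show "p + q \<in> comb v ` nonneg_on S"
      by (rule image_eqI [rotated]) (simp add: comb_add cd)
  next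
    fix p and r :: real assume "p \<in> comb v ` nonneg_on S" "0 \<le> r"
    then obtain c where "c \<in> nonneg_on S" "p = comb v c" by blast
    with \<open>0 \<le> r\<close> show "r *\<^sub>R p \<in> comb v ` nonneg_on S"
      by (intro image_eqI [where x = "\<lambda>x. r * c x"]) (auto simp: comb_scale nonneg_on_def)
  qed
  moreover have "v ` S \<subseteq> comb v ` nonneg_on S"
  proof
    fix p assume "p \<in> v ` S"
    then obtain x where "x \<in> S" "p = v x" by blast
    then show "p \<in> comb v ` nonneg_on S"
      by (intro image_eqI [where x = "\<lambda>y. if y = x then 1 else 0"])
         (auto simp: comb_unit nonneg_on_def)
  qed
  ultimately show "convex_cone hull (v ` S) \<subseteq> comb v ` nonneg_on S"
    by (simp add: hull_minimal)
  show "comb v ` nonneg_on S \<subseteq> convex_cone hull (v ` S)"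
  proof
    fix p assume "p \<in> comb v ` nonneg_on S"
    then obtain c where c: "c \<in> nonneg_on S" and p: "p = comb v c" by blast
    let ?C = "convex_cone hull (v ` S)"
    have "(\<Sum>x\<in>T. c x *\<^sub>R v x) \<in> ?C" for T :: "'a set"
      using finite [of T]
    proof (induction T rule: finite_induct)
      case empty
      then show ?case by (simp add: convex_cone_hull_contains_0)
    next
      case (insert x T)
      have "c x *\<^sub>R v x \<in> ?C"
      proof (cases "x \<in> S")
        case True
        then show ?thesis
          using nonneg_onD(1)[OF c] by (simp add: convex_cone_hull_mul hull_inc)
      next
        case False
        then show ?thesis
          using nonneg_onD(2)[OF c] by (simp add: convex_cone_hull_contains_0)
      qed
      with insert show ?case by (simp add: convex_cone_hull_add)
    qed
    then show "p \<in> ?C" by (simp add: p comb_def)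
  qed
qed

section \<open>Faces of convex cones\<close>

lemma face_of_convex_cone_contains_scaled:
  fixes C :: "'v::real_vector set"
  assumes "convex_cone C" "F face_of C" "x \<in> F" "0 \<le> r"
  shows "r *\<^sub>R x \<in> F"
proof (cases "x = 0 \<or> r = 1")
  case True
  then show ?thesis using assms by auto
next
  case False
  have x: "x \<in> C" using assms(2,3) face_of_imp_subset by blast
  \<comment> \<open>A nonzero \<open>x\<close> lies strictly between 0 and \<open>2 x\<close>, so a
    face through \<open>x\<close> contains 0. Convexity then covers factors up to 1; for
    \<open>r > 1\<close> the point \<open>x\<close> itself lies strictly between 0 and
    \<open>r x\<close>.\<close>
  have 0: "0 \<in> F"
  proof -
    have "x \<in> open_segment 0 (2 *\<^sub>R x)"
      unfolding in_segment using False by (auto intro!: exI [where x = "1/2"])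
    then show ?thesis
      using face_ofD [OF assms(2)] assms(1,3) x
      by (metis convex_cone_contains_0 convex_cone_scaleR zero_le_numeral)
  qed
  show ?thesis
  proof (cases "r \<le> 1")
    case True
    have "convex F" using assms(2) face_of_imp_convex by blast
    then have "(1 - r) *\<^sub>R 0 + r *\<^sub>R x \<in> F"
      using 0 assms(3,4) True by (intro convexD_alt) auto
    then show ?thesis by simp
  next
    case gt: False
    then have "x \<in> open_segment 0 (r *\<^sub>R x)"
      unfolding in_segment using False by (auto intro!: exI [where x = "1/r"])
    then show ?thesis
      using face_ofD [OF assms(2)] assms(1,3,4) x
      by (metis convex_cone_contains_0 convex_cone_scaleR)
  qed
qed

text \<open>The point \<open>x + y\<close> is the midpoint of \<open>2 x\<close> and
  \<open>2 y\<close>. For \<open>x = y\<close> this open segment is empty, hence the separate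
  case.\<close>

lemma face_of_convex_cone_summand:
  fixes C :: "'v::real_vector set"
  assumes "convex_cone C" "F face_of C" "x + y \<in> F" "x \<in> C" "y \<in> C"
  shows "x \<in> F"
proof (cases "x = y")
  case True
  then have "x = (1/2) *\<^sub>R (x + y)" by (simp add: scaleR_2 [symmetric])
  then show ?thesis
    using face_of_convex_cone_contains_scaled [OF assms(1-3), of "1/2"] by simp
next
  case False
  have "x + y \<in> open_segment (2 *\<^sub>R x) (2 *\<^sub>R y)"
    unfolding in_segment using False by (auto intro!: exI [where x = "1/2"])
  then have "2 *\<^sub>R x \<in> F"
    using face_ofD [OF assms(2)] assms(1,3-5) by (meson convex_cone_scaleR zero_le_numeral)
  then have "(1/2) *\<^sub>R 2 *\<^sub>R x \<in> F"
    using face_of_convex_cone_contains_scaled [OF assms(1,2)]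
    by (metis zero_le_divide_1_iff zero_le_numeral)
  then show ?thesis by simp
qed

text \<open>The stellar subdivision of an abstract simplicial complex \<open>N\<close> in the
  simplex \<open>F\<close>, with new vertex \<open>x\<close>.\<close>

definition link_extension :: "'a set set \<Rightarrow> 'a set \<Rightarrow> 'a \<Rightarrow> 'a set set" where
  "link_extension N F x =
    {S \<in> N. \<not> F \<subseteq> S} \<union> {insert x S | S. S \<in> N \<and> \<not> F \<subseteq> S \<and> S \<union> F \<in> N}"

text \<open>\<open>comb_inj\<close> compares representations over two possibly different simplices.
  For equal ones it yields linear independence of the generators, for different ones that cones meet
  in the cone of the common generators.\<close>

locale cone_complex =
  fixes v :: "'a::finite \<Rightarrow> 'v::euclidean_space" and N :: "'a set set"
  assumes empty_mem: "{} \<in> N"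
    and subset_mem: "\<And>S T. S \<in> N \<Longrightarrow> T \<subseteq> S \<Longrightarrow> T \<in> N"
    and comb_inj: "\<And>S T c d. S \<in> N \<Longrightarrow> T \<in> N \<Longrightarrow> c \<in> nonneg_on S \<Longrightarrow> d \<in> nonneg_on T \<Longrightarrow>
      comb v c = comb v d \<Longrightarrow> c = d"
begin

section \<open>Simplicial fans from complexes of cones\<close>

definition vcone :: "'a set \<Rightarrow> 'v set" where
  "vcone S = convex_cone hull (v ` S)"

lemma vcone_eq: "vcone S = comb v ` nonneg_on S"
  by (simp add: vcone_def convex_cone_hull_eq_comb)

lemma convex_cone_vcone: "convex_cone (vcone S)"
  by (simp add: vcone_def convex_cone_convex_cone_hull)

lemma vcone_mono: "S \<subseteq> T \<Longrightarrow> vcone S \<subseteq> vcone T"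
  by (simp add: vcone_def hull_mono image_mono)

lemma vec_in_vcone: "x \<in> S \<Longrightarrow> v x \<in> vcone S"
  by (simp add: vcone_def hull_inc)

lemma vec_in_vcone_iff:
  assumes "S \<in> N" "{x} \<in> N"
  shows "v x \<in> vcone S \<longleftrightarrow> x \<in> S"
proof
  assume "v x \<in> vcone S"
  then obtain c where c: "c \<in> nonneg_on S" "comb v c = v x" unfolding vcone_eq by force
  let ?d = "\<lambda>y. if y = x then 1 else (0::real)"
  have "c = ?d"
  proof (rule comb_inj [OF assms c(1)])
    show "?d \<in> nonneg_on {x}" by (simp add: nonneg_on_def)
    show "comb v c = comb v ?d" using c(2) by (simp add: comb_unit)
  qed
  then show "x \<in> S" using nonneg_onD(2) [OF c(1), of x] by auto
qed (rule vec_in_vcone)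

lemma vcone_subset_iff:
  assumes "S \<in> N" "T \<in> N"
  shows "vcone S \<subseteq> vcone T \<longleftrightarrow> S \<subseteq> T"
proof
  assume sub: "vcone S \<subseteq> vcone T"
  show "S \<subseteq> T"
  proof
    fix x assume "x \<in> S"
    then show "x \<in> T"
      using sub vec_in_vcone [of x S] vec_in_vcone_iff [OF assms(2), of x] subset_mem [OF assms(1), of "{x}"]
      by auto
  qed
qed (rule vcone_mono)

lemma vcone_Int:
  assumes "S \<in> N" "T \<in> N"
  shows "vcone S \<inter> vcone T = vcone (S \<inter> T)"
proof
  show "vcone S \<inter> vcone T \<subseteq> vcone (S \<inter> T)"
  proof
    fix p assume "p \<in> vcone S \<inter> vcone T"
    then obtain c d where cd: "c \<in> nonneg_on S" "p = comb v c" "d \<in> nonneg_on T" "p = comb v d"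
      unfolding vcone_eq by blast
    then have "c = d" using comb_inj assms by metis
    with cd have "c \<in> nonneg_on (S \<inter> T)" by (auto simp: nonneg_on_def)
    with cd show "p \<in> vcone (S \<inter> T)" unfolding vcone_eq by blast
  qed
qed (simp add: vcone_mono)

lemma vcone_face:
  assumes "T \<in> N" "S \<subseteq> T"
  shows "vcone S face_of vcone T"
  unfolding face_of_def
proof (intro conjI ballI impI)
  show "vcone S \<subseteq> vcone T" using assms by (simp add: vcone_mono)
  show "convex (vcone S)" using convex_cone_vcone unfolding convex_cone_def by blast
  fix a b x assume ab: "a \<in> vcone T" "b \<in> vcone T" and x: "x \<in> vcone S" "x \<in> open_segment a b"
  from ab obtain c d where c: "c \<in> nonneg_on T" "a = comb v c" and d: "d \<in> nonneg_on T" "b = comb v d"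
    unfolding vcone_eq by blast
  from x obtain e where e: "e \<in> nonneg_on S" "x = comb v e" unfolding vcone_eq by blast
  from x obtain u where u: "0 < u" "u < 1" "x = (1 - u) *\<^sub>R a + u *\<^sub>R b"
    by (auto simp: in_segment)
  \<comment> \<open>By uniqueness the coefficients of an inner point of the segment are the convex
    combination of those of its ends. Where it vanishes, both nonnegative terms vanish.\<close>
  have "e = (\<lambda>y. (1 - u) * c y + u * d y)"
  proof (rule comb_inj [OF assms(1) assms(1)])
    show "e \<in> nonneg_on T" using e(1) assms(2) by (rule nonneg_on_mono)
    show "(\<lambda>y. (1 - u) * c y + u * d y) \<in> nonneg_on T"
      using c(1) d(1) u by (auto simp: nonneg_on_def)
    show "comb v e = comb v (\<lambda>y. (1 - u) * c y + u * d y)"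
      using e(2) u(3) c(2) d(2) by (simp add: comb_add comb_scale)
  qed
  then have eq: "e y = (1 - u) * c y + u * d y" for y by simp
  have "c y = 0 \<and> d y = 0" if "y \<notin> S" for y
  proof -
    have "(1 - u) * c y + u * d y = 0" using eq nonneg_onD(2) [OF e(1) that] by metis
    moreover have "0 \<le> (1 - u) * c y" "0 \<le> u * d y"
      using u nonneg_onD(1) [OF c(1)] nonneg_onD(1) [OF d(1)] by auto
    ultimately show ?thesis using u by (simp add: add_nonneg_eq_0_iff)
  qed
  then have "c \<in> nonneg_on S" "d \<in> nonneg_on S"
    using c(1) d(1) by (auto simp: nonneg_on_def)
  then show "a \<in> vcone S" "b \<in> vcone S" using c d unfolding vcone_eq by blast+
qed

text \<open>The face is spanned by the generators it contains: if a generator occurs with positive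
  coefficient in a point of \<open>F\<close>, its term is a summand of that point and so lies in
  \<open>F\<close>.\<close>

lemma face_of_vcone_eq:
  assumes "F face_of vcone S" "F \<noteq> {}"
  shows "\<exists>T\<subseteq>S. F = vcone T"
proof (intro exI [where x = "{x \<in> S. v x \<in> F}"] conjI)
  let ?T = "{x \<in> S. v x \<in> F}"
  note scaled = face_of_convex_cone_contains_scaled [OF convex_cone_vcone assms(1)]
  have "convex F" "F \<subseteq> vcone S" using assms(1) face_of_imp_convex face_of_imp_subset by blast+
  have "convex_cone F"
    unfolding convex_cone_iff
  proof (intro conjI ballI allI impI)
    obtain x where "x \<in> F" using assms(2) by blast
    then show "0 \<in> F" using scaled [of x 0] by simp
  next
    fix x y assume "x \<in> F" "y \<in> F"
    then have "(1/2) *\<^sub>R x + (1/2) *\<^sub>R y \<in> F" using \<open>convex F\<close> by (simp add: convexD)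
    then have "2 *\<^sub>R ((1/2) *\<^sub>R x + (1/2) *\<^sub>R y) \<in> F" using scaled by simp
    then show "x + y \<in> F" by (simp add: scaleR_add_right)
  qed (use scaled in auto)
  show "F = vcone ?T"
  proof
    show "vcone ?T \<subseteq> F"
      unfolding vcone_def by (rule hull_minimal) (use \<open>convex_cone F\<close> in auto)
    show "F \<subseteq> vcone ?T"
    proof
      fix p assume "p \<in> F"
      then obtain c where c: "c \<in> nonneg_on S" "p = comb v c"
        using \<open>F \<subseteq> vcone S\<close> unfolding vcone_eq by blast
      have "v x \<in> F" if "c x \<noteq> 0" for x
      proof -
        have x: "x \<in> S" "0 < c x" using c(1) that by (auto simp: nonneg_on_def less_le)
        have "(\<lambda>y. c y - (if y = x then c x else 0)) \<in> nonneg_on S"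
          using c(1) by (auto simp: nonneg_on_def)
        moreover have "p - c x *\<^sub>R v x = comb v (\<lambda>y. c y - (if y = x then c x else 0))"
          by (simp only: comb_diff comb_unit c(2))
        ultimately have "p - c x *\<^sub>R v x \<in> vcone S"
          unfolding vcone_eq by blast
        moreover have "c x *\<^sub>R v x \<in> vcone S"
          using x vec_in_vcone convex_cone_vcone by (simp add: convex_cone_scaleR)
        ultimately have "c x *\<^sub>R v x \<in> F"
          using face_of_convex_cone_summand [OF convex_cone_vcone assms(1), of _ "p - c x *\<^sub>R v x"]
            \<open>p \<in> F\<close> by simp
        then show ?thesis using scaled [of "c x *\<^sub>R v x" "1 / c x"] x(2) by simp
      qed
      then have "c \<in> nonneg_on ?T" using c(1) by (auto simp: nonneg_on_def)
      then show "p \<in> vcone ?T" using c(2) unfolding vcone_eq by blast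
    qed
  qed
qed auto

lemma vcone_face_iff:
  assumes "S \<in> N" "T \<in> N"
  shows "vcone S face_of vcone T \<longleftrightarrow> S \<subseteq> T"
  using vcone_face vcone_subset_iff [OF assms] assms face_of_imp_subset by blast

lemma simplicial_cone_vcone:
  assumes "S \<in> N"
  shows "simplicial_cone (vcone S)"
  unfolding simplicial_cone_def
proof (intro exI conjI)
  show "vcone S = convex_cone hull (v ` S)" by (rule vcone_def)
  have inj: "inj_on v S"
  proof (rule inj_onI)
    fix x y assume "x \<in> S" "y \<in> S" "v x = v y"
    moreover from this have "{x} \<in> N" "{y} \<in> N" using subset_mem [OF assms] by auto
    ultimately show "x = y" using vec_in_vcone_iff [of "{x}" y] vec_in_vcone [of x "{x}"] by auto
  qed
  show "independent (v ` S)"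
  proof (rule independent_if_scalars_zero)
    fix u p assume sum: "(\<Sum>q\<in>v ` S. u q *\<^sub>R q) = 0" and "p \<in> v ` S"
    then obtain x where x: "x \<in> S" "p = v x" by blast
    \<comment> \<open>A linear relation is split into its positive part \<open>c\<close> and
      negative part \<open>d\<close>. These represent the same point, so they agree; at each
      generator one of them is 0, so both are.\<close>
    define c where "c = (\<lambda>x. if x \<in> S then max (u (v x)) 0 else 0)"
    define d where "d = (\<lambda>x. if x \<in> S then max (- u (v x)) 0 else 0)"
    have "comb v c - comb v d = comb v (\<lambda>x. c x - d x)" by (simp add: comb_diff)
    also have "\<dots> = (\<Sum>x\<in>S. u (v x) *\<^sub>R v x)"
      unfolding comb_def by (rule sum.mono_neutral_cong_right) (auto simp: c_def d_def)
    also have "\<dots> = 0" using sum inj by (simp add: sum.reindex)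
    finally have "comb v c = comb v d" by simp
    moreover have "c \<in> nonneg_on S" "d \<in> nonneg_on S" by (auto simp: c_def d_def nonneg_on_def)
    ultimately have "c = d" using comb_inj assms by metis
    then have "c x = d x" by simp
    then show "u p = 0" using x by (auto simp: c_def d_def split: if_splits)
  qed simp
qed

theorem simplicial_fan_cones: "simplicial_fan (vcone ` N)"
  unfolding simplicial_fan_def
proof (intro conjI ballI allI impI)
  fix \<sigma> \<tau> assume "\<sigma> \<in> vcone ` N" "\<tau> \<in> vcone ` N"
  then obtain S T where "S \<in> N" "T \<in> N" "\<sigma> = vcone S" "\<tau> = vcone T" by blast
  then show "\<sigma> \<inter> \<tau> face_of \<sigma>" "\<sigma> \<inter> \<tau> face_of \<tau>"
    by (simp_all add: vcone_Int vcone_face)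
next
  fix \<sigma> \<tau> assume "\<sigma> \<in> vcone ` N" "\<tau> face_of \<sigma> \<and> \<tau> \<noteq> {}"
  then show "\<tau> \<in> vcone ` N" using face_of_vcone_eq subset_mem by blast
qed (use empty_mem simplicial_cone_vcone in auto)

lemma vcone_insert: "vcone (insert x S) = {y + r *\<^sub>R v x | y r. y \<in> vcone S \<and> 0 \<le> r}"
proof
  show "vcone (insert x S) \<subseteq> {y + r *\<^sub>R v x | y r. y \<in> vcone S \<and> 0 \<le> r}"
  proof
    fix p assume "p \<in> vcone (insert x S)"
    then obtain c where c: "c \<in> nonneg_on (insert x S)" "p = comb v c" unfolding vcone_eq by blast
    let ?d = "\<lambda>y. c y - (if y = x then c x else 0)"
    have "?d \<in> nonneg_on S" using c(1) by (auto simp: nonneg_on_def)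
    moreover have "p = comb v ?d + c x *\<^sub>R v x" using c(2) by (simp add: comb_diff comb_unit)
    ultimately show "p \<in> {y + r *\<^sub>R v x | y r. y \<in> vcone S \<and> 0 \<le> r}"
      using nonneg_onD(1) [OF c(1)] unfolding vcone_eq by blast
  qed
  show "{y + r *\<^sub>R v x | y r. y \<in> vcone S \<and> 0 \<le> r} \<subseteq> vcone (insert x S)"
    using vcone_mono [of S "insert x S"] vec_in_vcone [of x "insert x S"] convex_cone_vcone
    by (fastforce intro: convex_cone_add convex_cone_scaleR)
qed

text \<open>A point of a convex set is relatively interior if every segment from the set to it can
  be prolonged beyond it within the set.\<close>

lemma sum_in_rel_interior_vcone: "sum v F \<in> rel_interior (vcone F)"
proof -
  have "\<exists>e>1. (1 - e) *\<^sub>R p + e *\<^sub>R sum v F \<in> vcone F" if p: "p \<in> vcone F" for p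
  proof -
    obtain c where c: "c \<in> nonneg_on F" "p = comb v c" using p unfolding vcone_eq by blast
    define m where "m = (\<Sum>x\<in>UNIV. c x)"
    have m: "c x \<le> m" "0 \<le> m" for x
      unfolding m_def using nonneg_onD(1) [OF c(1)] by (auto intro: member_le_sum sum_nonneg)
    \<comment> \<open>As \<open>m\<close> bounds all coefficients of \<open>p\<close>, the
      prolongation subtracts at most 1 from each, while the sum contributes \<open>e > 1\<close> on
      \<open>F\<close>.\<close>
    define e where "e = 1 + 1 / (1 + m)"
    have e: "e > 1" using m(2) by (simp add: e_def add_nonneg_pos)
    let ?d = "\<lambda>x. (1 - e) * c x + e * indicator F x"
    have "(1 - e) * c x + e \<ge> 0" for x
    proof -
      have "c x / (1 + m) \<le> 1" using m(1) [of x] m(2) by simp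
      then have "(1 - e) * c x \<ge> - 1" by (simp add: e_def)
      then show ?thesis using e by linarith
    qed
    then have "?d \<in> nonneg_on F"
      using nonneg_onD(2) [OF c(1)] by (auto simp: nonneg_on_def indicator_def)
    moreover have "(1 - e) *\<^sub>R p + e *\<^sub>R sum v F = comb v ?d"
      by (simp add: comb_add comb_scale comb_indicator c(2))
    ultimately show ?thesis using e unfolding vcone_eq by blast
  qed
  moreover have "convex (vcone F)" "vcone F \<noteq> {}"
    using convex_cone_vcone by (auto simp: convex_cone_def)
  ultimately show ?thesis by (simp add: convex_rel_interior_iff)
qed

section \<open>Stellar subdivision of such a fan\<close>

context
  fixes F :: "'a set" and x :: 'a
  assumes F: "F \<in> N" "F \<noteq> {}" and vx: "v x = sum v F"
begin

text \<open>Faces of cones correspond to inclusions of simplices, so \<open>S\<close> and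
  \<open>F\<close> span faces of a common cone exactly if \<open>S \<union> F\<close> is a
  simplex.\<close>

lemma stellar_cones: "stellar (vcone ` N) (vcone F) (v x) = vcone ` link_extension N F x"
proof -
  have face: "vcone F face_of vcone S \<longleftrightarrow> F \<subseteq> S" if "S \<in> N" for S
    using that F by (simp add: vcone_face_iff)
  have old: "{\<rho> \<in> vcone ` N. \<not> vcone F face_of \<rho>} = vcone ` {S \<in> N. \<not> F \<subseteq> S}"
    using face by auto
  have new: "(\<exists>\<tau>\<in>vcone ` N. vcone F face_of \<tau> \<and> vcone S face_of \<tau>) \<longleftrightarrow> S \<union> F \<in> N"
    if S: "S \<in> N" for S
  proof
    assume "\<exists>\<tau>\<in>vcone ` N. vcone F face_of \<tau> \<and> vcone S face_of \<tau>"
    then obtain T where "T \<in> N" "F \<subseteq> T" "S \<subseteq> T" using face vcone_face_iff [OF S] by auto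
    then show "S \<union> F \<in> N" using subset_mem by simp
  next
    assume "S \<union> F \<in> N"
    then show "\<exists>\<tau>\<in>vcone ` N. vcone F face_of \<tau> \<and> vcone S face_of \<tau>"
      using vcone_face by blast
  qed
  have "{{y + r *\<^sub>R v x | y r. y \<in> \<rho> \<and> 0 \<le> r} | \<rho>. \<rho> \<in> vcone ` N \<and> \<not> vcone F face_of \<rho> \<and>
       (\<exists>\<tau>\<in>vcone ` N. vcone F face_of \<tau> \<and> \<rho> face_of \<tau>)}
    = vcone ` {insert x S | S. S \<in> N \<and> \<not> F \<subseteq> S \<and> S \<union> F \<in> N}" (is "?L = ?R")
  proof (intro equalityI subsetI)
    fix C assume "C \<in> ?L"
    then obtain S where "C = {y + r *\<^sub>R v x | y r. y \<in> vcone S \<and> 0 \<le> r}" "S \<in> N"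
      "\<not> vcone F face_of vcone S" "\<exists>\<tau>\<in>vcone ` N. vcone F face_of \<tau> \<and> vcone S face_of \<tau>"
      by blast
    then have "C = vcone (insert x S)" "S \<in> N" "\<not> F \<subseteq> S" "S \<union> F \<in> N"
      using face new by (auto simp: vcone_insert)
    then show "C \<in> ?R" by blast
  next
    fix C assume "C \<in> ?R"
    then obtain S where S: "C = vcone (insert x S)" "S \<in> N" "\<not> F \<subseteq> S" "S \<union> F \<in> N" by blast
    have "C = {y + r *\<^sub>R v x | y r. y \<in> vcone S \<and> 0 \<le> r}" using S(1) by (simp add: vcone_insert)
    moreover have "vcone S \<in> vcone ` N" using S(2) by simp
    moreover have "\<not> vcone F face_of vcone S" using S(2,3) face by simp
    moreover have "\<exists>\<tau>\<in>vcone ` N. vcone F face_of \<tau> \<and> vcone S face_of \<tau>"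
      using S(2,4) new by blast
    ultimately show "C \<in> ?L" by blast
  qed
  with old show ?thesis by (simp add: stellar_def link_extension_def image_Un)
qed

lemma vec_nonzero: "v x \<noteq> 0"
proof
  assume "v x = 0"
  \<comment> \<open>Otherwise the zero vector would have a second representation, with coefficient 1
    on the nonempty \<open>F\<close>.\<close>
  have "indicator F = (\<lambda>y. 0 :: real)"
  proof (rule comb_inj [OF F(1) empty_mem])
    show "comb v (indicator F) = comb v (\<lambda>y. 0)"
      using \<open>v x = 0\<close> by (simp add: comb_indicator vx)
  qed (auto simp: nonneg_on_def indicator_def)
  then show False using F(2) by (metis all_not_in_conv indicator_eq_0_iff)
qed

theorem stellar_subdivision_link_extension:
  "stellar_subdivision (vcone ` N) (vcone ` link_extension N F x)"
  unfolding stellar_subdivision_def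
proof (intro conjI bexI)
  show "v x \<in> rel_interior (vcone F)" by (simp add: vx sum_in_rel_interior_vcone)
qed (use F(1) simplicial_fan_cones stellar_cones vec_nonzero in auto)

lemma Union_link_extension: "\<Union>(vcone ` link_extension N F x) = \<Union>(vcone ` N)"
proof
  have "vcone (insert x S) \<subseteq> vcone (S \<union> F)" for S
  proof -
    have "v x \<in> vcone (S \<union> F)"
      unfolding vcone_eq vx comb_indicator [symmetric]
      by (rule imageI) (auto simp: nonneg_on_def indicator_def)
    then show ?thesis
      unfolding vcone_def [of "insert x S"]
      by (intro hull_minimal) (use vec_in_vcone [of _ "S \<union> F"] convex_cone_vcone in auto)
  qed
  then show "\<Union>(vcone ` link_extension N F x) \<subseteq> \<Union>(vcone ` N)"
    unfolding link_extension_def by blast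
  show "\<Union>(vcone ` N) \<subseteq> \<Union>(vcone ` link_extension N F x)"
  proof
    fix p assume "p \<in> \<Union>(vcone ` N)"
    then obtain T where T: "T \<in> N" "p \<in> vcone T" by blast
    show "p \<in> \<Union>(vcone ` link_extension N F x)"
    proof (cases "F \<subseteq> T")
      case False
      with T show ?thesis unfolding link_extension_def by blast
    next
      case True
      obtain c where c: "c \<in> nonneg_on T" "p = comb v c" using T(2) unfolding vcone_eq by blast
      \<comment> \<open>Trading the smallest coefficient on \<open>F\<close> for a multiple of
        \<open>v x\<close> keeps all coefficients nonnegative and makes the one at \<open>z\<close>
        vanish. The remaining simplex omits \<open>z\<close>, so it no longer contains
        \<open>F\<close>.\<close>
      obtain z where z: "z \<in> F" "\<And>y. y \<in> F \<Longrightarrow> c z \<le> c y"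
        using F(2) ex_is_arg_min_if_finite [of F c] by (force simp: is_arg_min_linorder)
      let ?d = "\<lambda>y. c y - c z * indicator F y"
      have "?d \<in> nonneg_on (T - {z})"
        using c(1) z True by (auto simp: nonneg_on_def indicator_def)
      then have "comb v ?d \<in> vcone (T - {z})" unfolding vcone_eq by blast
      moreover have "p = comb v ?d + c z *\<^sub>R v x"
        by (simp add: comb_diff comb_scale comb_indicator vx c(2))
      ultimately have "p \<in> vcone (insert x (T - {z}))"
        using nonneg_onD(1) [OF c(1)] unfolding vcone_insert by blast
      moreover have "insert x (T - {z}) \<in> link_extension N F x"
      proof -
        have "T - {z} \<in> N" "T - {z} \<union> F \<in> N" using T(1) True subset_mem by auto
        then show ?thesis using z(1) unfolding link_extension_def by blast
      qed
      ultimately show ?thesis by blast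
    qed
  qed
qed

end

end


section \<open>Building sets\<close>

lemma isLub_UNIV_iff: "isLub UNIV S J \<longleftrightarrow> (\<forall>u. J \<le> u \<longleftrightarrow> (\<forall>s\<in>S. s \<le> (u::'a::order)))"
  unfolding isLub_def leastP_def isUb_def setle_def setge_def by (auto intro: order_trans)

lemma isLub_UNIV_upper: "isLub UNIV S J \<Longrightarrow> s \<in> S \<Longrightarrow> s \<le> (J::'a::order)"
  by (auto simp: isLub_UNIV_iff)

lemma isLub_UNIV_least: "isLub UNIV S J \<Longrightarrow> (\<And>s. s \<in> S \<Longrightarrow> s \<le> u) \<Longrightarrow> J \<le> (u::'a::order)"
  by (auto simp: isLub_UNIV_iff)

lemma isLub_UNIV_intro:
  "(\<And>s. s \<in> S \<Longrightarrow> s \<le> J) \<Longrightarrow> (\<And>u. (\<And>s. s \<in> S \<Longrightarrow> s \<le> u) \<Longrightarrow> J \<le> u) \<Longrightarrow> isLub UNIV S (J::'a::order)"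
  unfolding isLub_def leastP_def isUb_def setle_def setge_def by blast

lemma isLub_UNIV_unique: "isLub UNIV S J \<Longrightarrow> isLub UNIV S K \<Longrightarrow> J = (K::'a::order)"
  unfolding isLub_UNIV_iff by (metis antisym order_refl)

lemma isLub_singleton: "isLub UNIV {x} (x::'a::order)"
  by (simp add: isLub_UNIV_iff)

lemma isLub_empty_iff: "isLub UNIV {} J \<longleftrightarrow> J = (bot::'a::order_bot)"
  unfolding isLub_UNIV_iff by (metis bot.extremum bot.extremum_unique empty_iff)

lemma bounded_imp_isLub:
  fixes u :: "'a::{finite,semilattice_inf}"
  assumes "\<And>s. s \<in> S \<Longrightarrow> s \<le> u"
  shows "\<exists>J\<le>u. isLub UNIV S J"
proof (intro exI conjI)
  \<comment> \<open>The join is the meet of all upper bounds, a set that is finite and contains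
    \<open>u\<close>.\<close>
  let ?U = "{u. \<forall>s\<in>S. s \<le> u}"
  have u: "u \<in> ?U" using assms by simp
  show "Inf_fin ?U \<le> u" using u by (intro Inf_fin.coboundedI) auto
  show "isLub UNIV S (Inf_fin ?U)"
  proof (rule isLub_UNIV_intro)
    fix s assume "s \<in> S"
    then show "s \<le> Inf_fin ?U" using u by (intro Inf_fin.boundedI) auto
  next
    fix w assume "\<And>s. s \<in> S \<Longrightarrow> s \<le> w"
    then show "Inf_fin ?U \<le> w" by (intro Inf_fin.coboundedI) auto
  qed
qed

lemma le_maximals:
  fixes x :: "'a::{finite,order}"
  assumes "x \<in> S"
  shows "\<exists>m\<in>maximals S. x \<le> m"
  using finite_has_maximal2 [of S x] assms unfolding maximals_def by auto

lemma maximals_subset: "maximals S \<subseteq> S"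
  by (auto simp: maximals_def)

abbreviation antichain :: "'a::order set \<Rightarrow> bool" where
  "antichain \<equiv> pairwise (\<lambda>x y. \<not> x \<le> y)"

lemma antichain_maximals: "antichain (maximals S)"
  by (auto simp: maximals_def pairwise_def)

lemma antichainD: "antichain T \<Longrightarrow> x \<in> T \<Longrightarrow> y \<in> T \<Longrightarrow> x \<le> y \<Longrightarrow> x = y"
  by (auto simp: pairwise_def)

text \<open>
  For \<open>M = max G\<^sub>\<le>\<^sub>X\<close> this is the building set condition at \<open>X\<close> with the isomorphism normalised to
  \<open>f \<mapsto> \<Squnion>\<^sub>j f j\<close>, whose inverse is \<open>Y \<mapsto> (Y \<sqinter> j)\<^sub>j\<close>. Given an isomorphism \<open>\<phi>\<close>, the two differ by
  automorphisms of the intervals \<open>[bot, j]\<close>.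
\<close>

definition decomposes :: "'a::semilattice_inf set \<Rightarrow> 'a \<Rightarrow> bool" where
  "decomposes M X \<longleftrightarrow> (\<forall>j\<in>M. j \<le> X) \<and> (\<forall>Y\<le>X. isLub UNIV (inf Y ` M) Y) \<and>
    (\<forall>f J. (\<forall>j\<in>M. f j \<le> j) \<and> isLub UNIV (f ` M) J \<longrightarrow> (\<forall>j\<in>M. inf J j = f j))"

lemma decomposes_le: "decomposes M X \<Longrightarrow> j \<in> M \<Longrightarrow> j \<le> X"
  by (simp add: decomposes_def)

lemma decomposes_isLub_inf: "decomposes M X \<Longrightarrow> Y \<le> X \<Longrightarrow> isLub UNIV (inf Y ` M) Y"
  by (simp add: decomposes_def)

lemma decomposes_inf_eq:
  "decomposes M X \<Longrightarrow> (\<And>j. j \<in> M \<Longrightarrow> f j \<le> j) \<Longrightarrow> isLub UNIV (f ` M) J \<Longrightarrow> j \<in> M \<Longrightarrow> inf J j = f j"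
  unfolding decomposes_def by blast

lemma decomposes_isLub:
  assumes "decomposes M X"
  shows "isLub UNIV M X"
proof -
  have "inf X ` M = M" using decomposes_le [OF assms] by (force simp: inf.absorb2)
  then show ?thesis using decomposes_isLub_inf [OF assms, of X] by simp
qed

lemma decomposes_disjoint:
  fixes X :: "'a::{semilattice_inf,order_bot}"
  assumes "decomposes M X" "i \<in> M" "j \<in> M" "i \<noteq> j"
  shows "inf i j = bot"
proof -
  \<comment> \<open>The tuple with \<open>i\<close> in its own coordinate and \<open>bot\<close>
    elsewhere has join \<open>i\<close>; its coordinate at \<open>j\<close> is therefore
    \<open>inf i j\<close>.\<close>
  let ?f = "\<lambda>k. if k = i then i else bot"
  have "isLub UNIV (?f ` M) i" using assms(2) by (auto simp: isLub_UNIV_iff)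
  then have "inf i j = ?f j" by (rule decomposes_inf_eq [OF assms(1) _ _ assms(3), rotated]) auto
  then show ?thesis using assms(4) by simp
qed

definition factors :: "'a::order set \<Rightarrow> 'a \<Rightarrow> 'a set" where
  "factors G X = maximals {Y \<in> G. Y \<le> X}"

lemma factorsD: "Y \<in> factors G X \<Longrightarrow> Y \<in> G \<and> Y \<le> X"
  by (simp add: factors_def maximals_def)

lemma factors_maximal: "Y \<in> factors G X \<Longrightarrow> Z \<in> G \<Longrightarrow> Z \<le> X \<Longrightarrow> Y \<le> Z \<Longrightarrow> Z = Y"
  by (simp add: factors_def maximals_def)

lemma factorsI: "Y \<in> G \<Longrightarrow> Y \<le> X \<Longrightarrow> (\<And>Z. Z \<in> G \<Longrightarrow> Z \<le> X \<Longrightarrow> Y \<le> Z \<Longrightarrow> Z = Y) \<Longrightarrow> Y \<in> factors G X"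
  by (simp add: factors_def maximals_def)

lemma le_factors:
  fixes X :: "'a::{finite,order}"
  shows "Y \<in> G \<Longrightarrow> Y \<le> X \<Longrightarrow> \<exists>Z\<in>factors G X. Y \<le> Z"
  unfolding factors_def using le_maximals [of Y "{Y \<in> G. Y \<le> X}"] by simp

lemma antichain_factors: "antichain (factors G X)"
  unfolding factors_def by (rule antichain_maximals)

text \<open>The building set condition in normalised form. It passes to smaller building sets
  without constructing any product isomorphism.\<close>

definition decomposing :: "'a::{semilattice_inf,order_bot} set \<Rightarrow> bool" where
  "decomposing G \<longleftrightarrow> bot \<notin> G \<and> (\<forall>X. X \<noteq> bot \<longrightarrow> decomposes (factors G X) X)"

lemma product_isomorphism_decomposes:
  fixes X :: "'a::{semilattice_inf,order_bot}"
  assumes M: "\<And>j. j \<in> M \<Longrightarrow> j \<le> X"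
    and bij: "bij_betw \<phi> (\<Pi>\<^sub>E j\<in>M. {bot..j}) {bot..X}"
    and mono: "\<And>f g. f \<in> (\<Pi>\<^sub>E j\<in>M. {bot..j}) \<Longrightarrow> g \<in> (\<Pi>\<^sub>E j\<in>M. {bot..j}) \<Longrightarrow>
      \<phi> f \<le> \<phi> g \<longleftrightarrow> (\<forall>j\<in>M. f j \<le> g j)"
    and unit: "\<And>i. i \<in> M \<Longrightarrow> \<phi> (\<lambda>j\<in>M. if j = i then i else bot) = i"
  shows "decomposes M X"
proof -
  define P where "P = (\<Pi>\<^sub>E j\<in>M. {bot..j})"
  define axis where "axis = (\<lambda>j (y::'a). \<lambda>i\<in>M. if i = j then y else bot)"
  note mono = mono [folded P_def]
  have P: "f j \<le> j" if "f \<in> P" "j \<in> M" for f j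
    using that by (auto simp: P_def PiE_def Pi_def)
  have surj: "\<exists>g\<in>P. \<phi> g = Y" if "Y \<le> X" for Y
  proof -
    have "Y \<in> \<phi> ` P" using bij that by (simp add: bij_betw_def P_def)
    then show ?thesis by blast
  qed
  have \<phi>_le: "\<phi> f \<le> X" if "f \<in> P" for f
    using bij that by (auto simp: bij_betw_def P_def)
  have axis_P: "axis j y \<in> P" if "j \<in> M" "y \<le> j" for j y
    using that by (auto simp: axis_def P_def)
  have axis_unit: "\<phi> (axis j j) = j" if "j \<in> M" for j
    using unit that by (simp add: axis_def)
  \<comment> \<open>Meeting with \<open>j\<close> corresponds to the tuple meet with
    \<open>axis j j\<close>, the preimage of \<open>j\<close>. This keeps the coordinate at
    \<open>j\<close> and sends the others to \<open>bot\<close>.\<close>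
  have component: "inf (\<phi> f) j = \<phi> (axis j (f j))" if f: "f \<in> P" and j: "j \<in> M" for f j
  proof (rule antisym)
    have "inf (\<phi> f) j \<le> X" using \<phi>_le [OF f] by (simp add: le_infI1)
    then obtain g where g: "g \<in> P" "\<phi> g = inf (\<phi> f) j" using surj by blast
    have "\<phi> g \<le> \<phi> f" "\<phi> g \<le> \<phi> (axis j j)" using g(2) axis_unit [OF j] by simp_all
    then have "\<forall>i\<in>M. g i \<le> f i \<and> g i \<le> axis j j i" using mono g(1) f axis_P [OF j] by simp
    then have "\<forall>i\<in>M. g i \<le> axis j (f j) i" by (auto simp: axis_def split: if_splits)
    then show "inf (\<phi> f) j \<le> \<phi> (axis j (f j))"
      using mono g axis_P [OF j P [OF f j]] by metis
    have "\<phi> (axis j (f j)) \<le> \<phi> f"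
      using mono axis_P [OF j P [OF f j]] f by (simp add: axis_def)
    moreover have "\<phi> (axis j (f j)) \<le> \<phi> (axis j j)"
      using mono axis_P [OF j P [OF f j]] axis_P [OF j order_refl] P [OF f j] by (simp add: axis_def)
    ultimately show "\<phi> (axis j (f j)) \<le> inf (\<phi> f) j" using axis_unit [OF j] by simp
  qed
  \<comment> \<open>Each interval below \<open>j\<close> is thus the image of the
    \<open>j\<close>-th axis. This reparametrises it and translates arbitrary elements
    \<open>f j\<close> into coordinates for \<open>\<phi>\<close>.\<close>
  have axis_surj: "\<exists>z\<le>j. \<phi> (axis j z) = y" if j: "j \<in> M" and y: "y \<le> j" for j y
  proof -
    obtain g where g: "g \<in> P" "\<phi> g = y" using surj y M [OF j] order_trans by blast
    have "\<phi> (axis j (g j)) = inf y j" using component [OF g(1) j] g(2) by simp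
    then show ?thesis using P [OF g(1) j] y by (auto simp: inf.absorb1)
  qed
  have join: "isLub UNIV (inf (\<phi> f) ` M) (\<phi> f)" if f: "f \<in> P" for f
  proof (rule isLub_UNIV_intro)
    fix u assume u: "\<And>s. s \<in> inf (\<phi> f) ` M \<Longrightarrow> s \<le> u"
    \<comment> \<open>The bound \<open>u\<close> need not lie below \<open>X\<close>; only its meet
      with \<open>\<phi> f\<close> certainly has coordinates.\<close>
    have "inf u (\<phi> f) \<le> X" using \<phi>_le [OF f] by (simp add: le_infI2)
    then obtain g where g: "g \<in> P" "\<phi> g = inf u (\<phi> f)" using surj by blast
    have "f j \<le> g j" if j: "j \<in> M" for j
    proof -
      have "\<phi> (axis j (f j)) \<le> \<phi> g"
        using u [of "inf (\<phi> f) j"] component [OF f j] g(2) j by (metis image_eqI inf.cobounded1 le_infI)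
      then have "axis j (f j) j \<le> g j" using mono axis_P [OF j P [OF f j]] g(1) j by blast
      then show ?thesis using j by (simp add: axis_def)
    qed
    then have "\<phi> f \<le> \<phi> g" using mono f g(1) by blast
    then show "\<phi> f \<le> u" using g(2) by simp
  qed auto
  show ?thesis
    unfolding decomposes_def
  proof (intro conjI ballI allI impI)
    fix Y assume "Y \<le> X"
    then show "isLub UNIV (inf Y ` M) Y" using join surj by blast
  next
    fix f J j assume fJ: "(\<forall>j\<in>M. f j \<le> j) \<and> isLub UNIV (f ` M) J" and j: "j \<in> M"
    then have "\<forall>j\<in>M. \<exists>z\<le>j. \<phi> (axis j z) = f j" using axis_surj by blast
    then obtain z where z: "\<And>j. j \<in> M \<Longrightarrow> z j \<le> j \<and> \<phi> (axis j (z j)) = f j" by metis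
    let ?g = "\<lambda>j\<in>M. z j"
    have g: "?g \<in> P" using z by (auto simp: P_def)
    have inf_g: "inf (\<phi> ?g) j = f j" if "j \<in> M" for j using component [OF g that] z that by simp
    then have "inf (\<phi> ?g) ` M = f ` M" by (rule image_cong [OF refl])
    then have "\<phi> ?g = J" using join [OF g] fJ isLub_UNIV_unique by metis
    then show "inf J j = f j" using inf_g [OF j] by simp
  qed (rule M)
qed

lemma building_set_decomposing:
  fixes G :: "'a::{semilattice_inf,order_bot} set"
  assumes "building_set G"
  shows "decomposing G"
  unfolding decomposing_def
proof (intro conjI allI impI)
  show "bot \<notin> G" using assms by (simp add: building_set_def)
  fix X :: 'a assume "X \<noteq> bot"
  then obtain \<phi> where "bij_betw \<phi> (\<Pi>\<^sub>E j\<in>factors G X. {bot..j}) {bot..X}"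
    "\<forall>f\<in>\<Pi>\<^sub>E j\<in>factors G X. {bot..j}. \<forall>g\<in>\<Pi>\<^sub>E j\<in>factors G X. {bot..j}.
      \<phi> f \<le> \<phi> g \<longleftrightarrow> (\<forall>j\<in>factors G X. f j \<le> g j)"
    "\<forall>i\<in>factors G X. \<phi> (\<lambda>j\<in>factors G X. if j = i then i else bot) = i"
    using assms unfolding building_set_def Let_def factors_def by blast
  then show "decomposes (factors G X) X"
    by (intro product_isomorphism_decomposes) (use factorsD in blast)+
qed

lemma decomposing_decomposes: "decomposing G \<Longrightarrow> X \<noteq> bot \<Longrightarrow> decomposes (factors G X) X"
  by (simp add: decomposing_def)

section \<open>Factors and decompositions after the removal of an element\<close>

lemma factors_remove_not_factor:
  fixes X :: "'a::{finite,order}"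
  assumes "X \<notin> factors G Y"
  shows "factors (G - {X}) Y = factors G Y"
proof
  show "factors G Y \<subseteq> factors (G - {X}) Y"
    using assms by (auto simp: factors_def maximals_def)
  show "factors (G - {X}) Y \<subseteq> factors G Y"
  proof
    fix Z assume Z: "Z \<in> factors (G - {X}) Y"
    then obtain W where W: "W \<in> factors G Y" "Z \<le> W" using le_factors [of Z G Y] factorsD by blast
    moreover have "W \<in> G - {X}" "W \<le> Y" using W(1) assms factorsD by blast+
    ultimately show "Z \<in> factors G Y" using factors_maximal [OF Z] by metis
  qed
qed

text \<open>Every remaining element below \<open>Y\<close> lies below a factor of \<open>Y\<close>.
  A factor of \<open>X\<close> stays maximal, since an element above it and below another factor
  \<open>V\<close> of \<open>Y\<close> would force it below \<open>inf X V\<close>, which is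
  \<open>bot\<close>.\<close>

lemma factors_remove_factor:
  fixes X :: "'a::{finite,semilattice_inf,order_bot}"
  assumes G: "decomposing G" and Y: "X \<in> factors G Y"
  shows "factors (G - {X}) Y = (factors G Y - {X}) \<union> factors (G - {X}) X"
proof -
  have "Y \<noteq> bot" using G Y factorsD [OF Y] unfolding decomposing_def by (metis bot.extremum_unique)
  note dec = decomposing_decomposes [OF G this]
  have XY: "X \<le> Y" using Y factorsD by blast
  show ?thesis
  proof (intro equalityI subsetI)
    fix Z assume Z: "Z \<in> factors (G - {X}) Y"
    then obtain W where W: "W \<in> factors G Y" "Z \<le> W" using le_factors [of Z G Y] factorsD by blast
    show "Z \<in> (factors G Y - {X}) \<union> factors (G - {X}) X"
    proof (cases "W = X")
      case True
      then have "Z \<in> factors (G - {X}) X"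
        using Z W(2) factorsD [OF Z] factors_maximal [OF Z] XY by (intro factorsI) (auto intro: order_trans)
      then show ?thesis ..
    next
      case False
      then have "W = Z" using factors_maximal [OF Z] factorsD [OF W(1)] W(2) by blast
      then show ?thesis using W(1) False by blast
    qed
  next
    fix Z assume "Z \<in> (factors G Y - {X}) \<union> factors (G - {X}) X"
    then show "Z \<in> factors (G - {X}) Y"
    proof
      assume "Z \<in> factors G Y - {X}"
      then show ?thesis by (auto simp: factors_def maximals_def)
    next
      assume Z: "Z \<in> factors (G - {X}) X"
      show ?thesis
      proof (rule factorsI)
        show "Z \<in> G - {X}" "Z \<le> Y" using factorsD [OF Z] XY by auto
        fix W assume W: "W \<in> G - {X}" "W \<le> Y" "Z \<le> W"
        obtain V where V: "V \<in> factors G Y" "W \<le> V" using le_factors [of W G Y] W by blast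
        show "W = Z"
        proof (cases "V = X")
          case True
          then show ?thesis using factors_maximal [OF Z] W V by blast
        next
          case False
          then have "inf X V = bot" using decomposes_disjoint [OF dec Y V(1)] by blast
          moreover have "Z \<le> inf X V" using W(3) V(2) factorsD [OF Z] by (auto intro: order_trans)
          ultimately have "Z = bot" by (simp add: bot.extremum_unique)
          then show ?thesis using G factorsD [OF Z] unfolding decomposing_def by blast
        qed
      qed
    qed
  qed
qed

text \<open>Associativity of products: the factor \<open>[bot, X]\<close> is replaced by its own
  factorisation.\<close>

lemma decomposes_refine:
  fixes X :: "'a::{finite,semilattice_inf}"
  assumes M: "decomposes M Y" and X: "X \<in> M" and F: "decomposes F X"
  shows "decomposes ((M - {X}) \<union> F) Y"
  unfolding decomposes_def
proof (intro conjI allI impI)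
  have XY: "X \<le> Y" using decomposes_le [OF M X] .
  show "\<forall>j\<in>(M - {X}) \<union> F. j \<le> Y"
    using decomposes_le [OF M] decomposes_le [OF F] XY by (auto intro: order_trans)
  fix Z assume "Z \<le> Y"
  show "isLub UNIV (inf Z ` ((M - {X}) \<union> F)) Z"
  proof (rule isLub_UNIV_intro)
    fix u assume u: "\<And>s. s \<in> inf Z ` ((M - {X}) \<union> F) \<Longrightarrow> s \<le> u"
    have "inf Z X \<le> u"
    proof (rule isLub_UNIV_least [OF decomposes_isLub_inf [OF F]])
      fix s assume "s \<in> inf (inf Z X) ` F"
      then obtain j where "j \<in> F" "s = inf (inf Z X) j" by blast
      moreover from this have "inf (inf Z X) j = inf Z j"
        using decomposes_le [OF F] by (simp add: inf.absorb2 inf.assoc)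
      ultimately show "s \<le> u" using u by blast
    qed simp
    then show "Z \<le> u"
      by (intro isLub_UNIV_least [OF decomposes_isLub_inf [OF M \<open>Z \<le> Y\<close>]]) (use u in blast)
  qed auto
next
  fix f J assume fJ: "(\<forall>j\<in>(M - {X}) \<union> F. f j \<le> j) \<and> isLub UNIV (f ` ((M - {X}) \<union> F)) J"
  have "f j \<le> X" if "j \<in> F" for j
    using fJ decomposes_le [OF F that] that by (blast intro: order_trans)
  \<comment> \<open>The coordinates in \<open>F\<close> are assembled into their join
    \<open>K\<close>, which serves as the coordinate at \<open>X\<close> in the coarse
    decomposition.\<close>
  then obtain K where K: "isLub UNIV (f ` F) K" "K \<le> X" using bounded_imp_isLub [of "f ` F" X] by blast
  define g where "g = (\<lambda>j. if j = X then K else f j)"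
  have "isLub UNIV (g ` M) J"
  proof (rule isLub_UNIV_intro)
    have "K \<le> J" using isLub_UNIV_least [OF K(1)] isLub_UNIV_upper fJ by blast
    then show "s \<le> J" if "s \<in> g ` M" for s
      using that isLub_UNIV_upper fJ unfolding g_def by fastforce
  next
    fix u assume u: "\<And>s. s \<in> g ` M \<Longrightarrow> s \<le> u"
    have "K \<le> u" using u [of "g X"] X by (simp add: g_def)
    have "f j \<le> u" if "j \<in> M - {X}" for j using u [of "g j"] that by (simp add: g_def)
    moreover have "f j \<le> u" if "j \<in> F" for j
      using isLub_UNIV_upper [OF K(1)] that \<open>K \<le> u\<close> by (blast intro: order_trans)
    ultimately show "J \<le> u"
      by (intro isLub_UNIV_least [of "f ` ((M - {X}) \<union> F)" J]) (use fJ in auto)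
  qed
  moreover have "g j \<le> j" if "j \<in> M" for j using fJ K(2) that by (simp add: g_def)
  ultimately have J: "inf J j = g j" if "j \<in> M" for j using decomposes_inf_eq [OF M] that by blast
  show "\<forall>j\<in>(M - {X}) \<union> F. inf J j = f j"
  proof
    fix j assume "j \<in> (M - {X}) \<union> F"
    then show "inf J j = f j"
    proof
      assume "j \<in> M - {X}"
      then show ?thesis using J [of j] by (simp add: g_def)
    next
      assume j: "j \<in> F"
      have "inf J j = inf (inf J X) j"
        using decomposes_le [OF F j] by (simp add: inf.absorb2 inf.assoc)
      also have "\<dots> = inf K j" using J [OF X] by (simp add: g_def)
      also have "\<dots> = f j" using decomposes_inf_eq [OF F _ K(1) j] fJ by blast
      finally show ?thesis .
    qed
  qed
qed

lemma decomposing_remove: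
  fixes X :: "'a::{finite,semilattice_inf,order_bot}"
  assumes G: "decomposing G" and X: "decomposes (factors (G - {X}) X) X"
  shows "decomposing (G - {X})"
  unfolding decomposing_def
proof (intro conjI allI impI)
  show "bot \<notin> G - {X}" using G by (simp add: decomposing_def)
  fix Y :: 'a assume "Y \<noteq> bot"
  then have dec: "decomposes (factors G Y) Y" using G by (rule decomposing_decomposes [rotated])
  show "decomposes (factors (G - {X}) Y) Y"
  proof (cases "X \<in> factors G Y")
    case True
    then show ?thesis using factors_remove_factor [OF G] decomposes_refine [OF dec _ X] by simp
  next
    case False
    then show ?thesis using factors_remove_not_factor dec by metis
  qed
qed


section \<open>Nested sets\<close>

lemma nested_isLub_not_mem:
  fixes G :: "'a::{finite,order} set"
  assumes "nested G S" "T \<subseteq> S" "antichain T" "x \<in> T" "y \<in> T" "x \<noteq> y" "isLub UNIV T J"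
  shows "J \<notin> G"
proof -
  have "card {x, y} \<le> card T" using assms by (intro card_mono) auto
  then have "card T \<ge> 2" using assms(6) by simp
  then obtain J' where "isLub UNIV T J'" "J' \<notin> G"
    using assms(1-3) finite [of T] unfolding nested_def by blast
  then show ?thesis using assms(7) isLub_UNIV_unique by metis
qed

lemma nestedI:
  fixes G :: "'a::{finite,order} set"
  assumes "S \<subseteq> G" "\<And>T x y. T \<subseteq> S \<Longrightarrow> antichain T \<Longrightarrow> x \<in> T \<Longrightarrow> y \<in> T \<Longrightarrow> x \<noteq> y \<Longrightarrow>
    \<exists>J. isLub UNIV T J \<and> J \<notin> G"
  shows "nested G S"
  unfolding nested_def
proof (intro conjI allI impI assms(1))
  fix T assume T: "T \<subseteq> S \<and> finite T \<and> card T \<ge> 2 \<and> antichain T"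
  then obtain x y where "x \<in> T" "y \<in> T" "x \<noteq> y"
    by (metis One_nat_def card_le_Suc0_iff_eq not_less_eq_eq numeral_2_eq_2)
  then show "\<exists>J. isLub UNIV T J \<and> J \<notin> G" using assms(2) T by blast
qed

lemma nested_subset: "nested G S \<Longrightarrow> T \<subseteq> S \<Longrightarrow> nested G T"
  unfolding nested_def by (meson subset_trans)

lemma nested_imp_subset: "nested G S \<Longrightarrow> S \<subseteq> G"
  by (simp add: nested_def)

lemma nested_isLub:
  fixes G :: "'a::{finite,order_bot} set"
  assumes "nested G S" "T \<subseteq> S" "antichain T"
  shows "\<exists>J. isLub UNIV T J"
proof (cases "\<exists>x\<in>T. \<exists>y\<in>T. x \<noteq> y")
  case True
  then obtain x y where "x \<in> T" "y \<in> T" "x \<noteq> y" by blast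
  then have "card {x, y} \<le> card T" by (intro card_mono) auto
  then have "card T \<ge> 2" using \<open>x \<noteq> y\<close> by simp
  then show ?thesis using assms finite [of T] unfolding nested_def by blast
next
  case False
  then consider "T = {}" | x where "T = {x}" by blast
  then show ?thesis using isLub_singleton isLub_empty_iff by cases blast+
qed

text \<open>The elements of \<open>T\<close> below a factor \<open>j\<close> of \<open>J\<close>
  have join \<open>j\<close>. As \<open>j\<close> belongs to \<open>G\<close>, nestedness leaves
  only one such element, namely \<open>j\<close>. So all factors lie in \<open>T\<close>, and they
  exhaust it because \<open>T\<close> is an antichain.\<close>

lemma nested_factors:
  fixes G :: "'a::{finite,semilattice_inf,order_bot} set"
  assumes G: "decomposing G" and T: "nested G T" "antichain T" "T \<noteq> {}" and J: "isLub UNIV T J"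
  shows "factors G J = T"
proof -
  have TG: "T \<subseteq> G" using T(1) by (rule nested_imp_subset)
  have "J \<noteq> bot"
    using T(3) TG G isLub_UNIV_upper [OF J] unfolding decomposing_def
    by (metis all_not_in_conv bot.extremum_unique subsetD)
  then have dec: "decomposes (factors G J) J" using G by (rule decomposing_decomposes [rotated])
  have below: "\<exists>i\<in>factors G J. t \<le> i" if "t \<in> T" for t
    using that TG isLub_UNIV_upper [OF J] by (intro le_factors) auto
  have sub: "j \<in> T" if j: "j \<in> factors G J" for j
  proof -
    let ?T = "{t \<in> T. t \<le> j}"
    have lub: "isLub UNIV ?T j"
    proof (rule isLub_UNIV_intro)
      fix u assume u: "\<And>s. s \<in> ?T \<Longrightarrow> s \<le> u"
      \<comment> \<open>The factor \<open>j\<close> is shrunk to \<open>inf u j\<close>, the others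
        are kept. The join of this tuple still bounds \<open>T\<close>, so it is \<open>J\<close>,
        and comparing coordinates at \<open>j\<close> gives \<open>j \<le> u\<close>.\<close>
      define f where "f = (\<lambda>i. if i = j then inf u j else i)"
      have f_le: "f i \<le> i" for i by (simp add: f_def)
      then have "f i \<le> J" if "i \<in> factors G J" for i
        using decomposes_le [OF dec that] order_trans by blast
      then obtain K where K: "isLub UNIV (f ` factors G J) K" "K \<le> J"
        using bounded_imp_isLub [of "f ` factors G J" J] by blast
      have "J \<le> K"
      proof (rule isLub_UNIV_least [OF J])
        fix t assume t: "t \<in> T"
        then obtain i where i: "i \<in> factors G J" "t \<le> i" using below by blast
        have "t \<le> f i" using u [of t] t i(2) by (auto simp: f_def)
        also have "f i \<le> K" using isLub_UNIV_upper [OF K(1)] i(1) by blast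
        finally show "t \<le> K" .
      qed
      with K have "isLub UNIV (f ` factors G J) J" by (metis antisym)
      then have "inf J j = f j" using decomposes_inf_eq [OF dec f_le] j by blast
      then have "j = inf u j" using decomposes_le [OF dec j] by (simp add: f_def inf.absorb2)
      then show "j \<le> u" by (metis inf.cobounded1)
    qed simp
    have anti: "antichain ?T" using T(2) by (rule pairwise_subset) auto
    have "j \<in> G" "j \<noteq> bot" using factorsD [OF j] G unfolding decomposing_def by auto
    then obtain t where t: "t \<in> ?T" using lub isLub_empty_iff by (metis all_not_in_conv)
    have "t' = t" if "t' \<in> ?T" for t'
      using nested_isLub_not_mem [OF T(1) _ anti t that] lub \<open>j \<in> G\<close> by blast
    then have "?T = {t}" using t by blast
    then have "j = t" using lub isLub_UNIV_unique [OF isLub_singleton, of t j] by simp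
    then show "j \<in> T" using t by blast
  qed
  moreover have "t \<in> factors G J" if t: "t \<in> T" for t
  proof -
    obtain i where i: "i \<in> factors G J" "t \<le> i" using below t by blast
    then have "t = i" using antichainD [OF T(2) t] sub by blast
    then show ?thesis using i by simp
  qed
  ultimately show ?thesis by blast
qed

lemma nested_disjoint:
  fixes G :: "'a::{finite,semilattice_inf,order_bot} set"
  assumes G: "decomposing G" and T: "nested G T" "antichain T" "x \<in> T" "y \<in> T" "x \<noteq> y"
  shows "inf x y = bot"
proof -
  obtain J where J: "isLub UNIV T J" using nested_isLub [OF T(1) order_refl T(2)] by blast
  have fac: "factors G J = T" using nested_factors [OF G T(1,2) _ J] T(3) by blast
  have "x \<noteq> bot" using G nested_imp_subset [OF T(1)] T(3) unfolding decomposing_def by blast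
  then have "J \<noteq> bot" using isLub_UNIV_upper [OF J T(3)] by (auto simp: bot.extremum_unique)
  then show ?thesis
    using decomposes_disjoint [OF decomposing_decomposes [OF G]] fac T(3-5) by blast
qed


section \<open>Uniqueness of nested representations\<close>

lemma atom_le_inf: "a \<in> atoms \<Longrightarrow> a \<le> x \<Longrightarrow> a \<le> y \<Longrightarrow> inf x y \<noteq> (bot::'a::{semilattice_inf,order_bot})"
  by (metis (mono_tags, lifting) atoms_def bot.extremum_unique le_inf_iff mem_Collect_eq)

text \<open>The atom is the join of its meets with the factors, so one of these meets is not
  \<open>bot\<close> and equals the atom. Uniqueness is disjointness of the factors.\<close>

lemma atom_le_decomposes:
  fixes X :: "'a::{semilattice_inf,order_bot}"
  assumes M: "decomposes M X" and a: "a \<in> atoms" "a \<le> X"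
  shows "\<exists>!j. j \<in> M \<and> a \<le> j"
proof (rule ex_ex1I)
  have "isLub UNIV (inf a ` M) a" using decomposes_isLub_inf [OF M a(2)] .
  moreover have "a \<noteq> bot" using a(1) by (simp add: atoms_def)
  ultimately obtain j where j: "j \<in> M" "inf a j \<noteq> bot"
    using isLub_UNIV_least [of "inf a ` M" a bot] by (auto simp: bot.extremum_unique)
  then have "inf a j = a" using a(1) by (simp add: atoms_def)
  then show "\<exists>j. j \<in> M \<and> a \<le> j" using j(1) by (metis inf.cobounded2)
next
  fix i j assume "i \<in> M \<and> a \<le> i" "j \<in> M \<and> a \<le> j"
  then show "i = j" using decomposes_disjoint [OF M] atom_le_inf [OF a(1)] by blast
qed

lemma char_vec_decomposes:
  fixes X :: "'a::{finite,semilattice_inf,order_bot}" and A :: "'n::finite \<Rightarrow> 'a"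
  assumes M: "decomposes M X" and A: "A ` I \<subseteq> atoms"
  shows "char_vec I A X = sum (char_vec I A) M"
proof (rule vec_eq_iff [THEN iffD2], rule allI)
  fix i
  have "(\<Sum>j\<in>M. char_vec I A j $ i) = char_vec I A X $ i"
  proof (cases "i \<in> I \<and> A i \<le> X")
    case True
    then have "A i \<in> atoms" using A by blast
    then have "\<exists>!j. j \<in> M \<and> A i \<le> j" using atom_le_decomposes [OF M] True by simp
    then obtain j where j: "j \<in> M" "\<And>k. k \<in> M \<Longrightarrow> A i \<le> k \<longleftrightarrow> k = j" by blast
    have "(\<Sum>k\<in>M. char_vec I A k $ i) = (\<Sum>k\<in>M. if k = j then 1 else 0)"
      by (rule sum.cong [OF refl]) (use True in \<open>simp add: char_vec_def j(2)\<close>)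
    then show ?thesis using True j(1) by (simp add: char_vec_def)
  next
    case False
    then have "\<not> (i \<in> I \<and> A i \<le> j)" if "j \<in> M" for j
      using decomposes_le [OF M that] order_trans by blast
    then have "char_vec I A j $ i = 0" if "j \<in> M" for j using that by (auto simp: char_vec_def)
    then show ?thesis using False by (simp add: char_vec_def)
  qed
  then show "char_vec I A X $ i = sum (char_vec I A) M $ i" by simp
qed

text \<open>
  The existence of such an atom is what allows to read off the coefficient of a maximal element
  of a nested set from the point that is represented.
\<close>

lemma private_atom:
  fixes G :: "'a::{finite,semilattice_inf,order_bot} set"
  assumes atomic: "\<And>X::'a. isLub UNIV {a \<in> atoms. a \<le> X} X"
    and G: "decomposing G" and S: "nested G S" and X: "X \<in> maximals S"
  shows "\<exists>a\<in>atoms. \<forall>Y\<in>S. a \<le> Y \<longleftrightarrow> Y = X"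
proof -
  \<comment> \<open>The join \<open>J\<close> of these elements is strictly below \<open>X\<close>,
    for \<open>X\<close> lies in \<open>G\<close> and cannot be the join of several nested
    incomparable elements. Atomicity then gives an atom below \<open>X\<close> but not below
    \<open>J\<close>.\<close>
  let ?M = "maximals {Y \<in> S. Y < X}"
  have MS: "?M \<subseteq> S" and MX: "\<And>Y. Y \<in> ?M \<Longrightarrow> Y < X" by (auto simp: maximals_def)
  obtain J where J: "isLub UNIV ?M J" using nested_isLub [OF S MS antichain_maximals] by blast
  have XG: "X \<in> G" using X nested_imp_subset [OF S] maximals_subset by blast
  have "J \<le> X" using isLub_UNIV_least [OF J] MX by (simp add: less_imp_le)
  have "J \<noteq> X"
  proof
    assume "J = X"
    then have eq: "x = y" if "x \<in> ?M" "y \<in> ?M" for x y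
      using nested_isLub_not_mem [OF S MS antichain_maximals that _ J] XG by blast
    show False
    proof (cases "?M = {}")
      case True
      then show ?thesis using J \<open>J = X\<close> XG G isLub_empty_iff unfolding decomposing_def by metis
    next
      case False
      then obtain Y where Y: "Y \<in> ?M" by blast
      then have "J \<le> Y" using isLub_UNIV_least [OF J] eq by blast
      then show ?thesis using MX [OF Y] \<open>J = X\<close> by simp
    qed
  qed
  then have "\<not> X \<le> J" using \<open>J \<le> X\<close> by simp
  then obtain a where a: "a \<in> atoms" "a \<le> X" "\<not> a \<le> J"
    using isLub_UNIV_least [OF atomic [of X]] by blast
  have "Y = X" if Y: "Y \<in> S" "a \<le> Y" for Y
  proof (rule ccontr)
    assume "Y \<noteq> X"
    show False
    proof (cases "Y \<le> X")
      case True
      then obtain Z where "Z \<in> ?M" "Y \<le> Z"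
        using le_maximals [of Y "{Y \<in> S. Y < X}"] Y(1) \<open>Y \<noteq> X\<close>
        by (auto simp: less_le)
      then show False using isLub_UNIV_upper [OF J] Y(2) a(3) by (blast intro: order_trans)
    next
      case False
      \<comment> \<open>Elements of \<open>S\<close> not below \<open>X\<close> lie below another
        maximal element, which is disjoint from \<open>X\<close>.\<close>
      obtain Z where Z: "Z \<in> maximals S" "Y \<le> Z" using le_maximals [OF Y(1)] by blast
      then have "Z \<noteq> X" using False by blast
      moreover have "nested G (maximals S)" using S maximals_subset by (rule nested_subset)
      ultimately have "inf X Z = bot" using nested_disjoint [OF G _ antichain_maximals X Z(1)] by blast
      then show False using atom_le_inf [OF a(1,2)] Y(2) Z(2) order_trans by blast
    qed
  qed
  then show ?thesis using a(1,2) by blast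
qed

lemma comb_char_vec_nth:
  assumes "i \<in> I"
  shows "comb (char_vec I A) c $ i = (\<Sum>x | A i \<le> x. c x)"
  using assms by (simp add: comb_def char_vec_def if_distrib [of "\<lambda>r. _ * r"] sum.If_cases cong: if_cong)

section \<open>Recovering a nested representation from its point\<close>

context
  fixes A :: "'n::finite \<Rightarrow> 'a::{finite,semilattice_inf,order_bot}" and I :: "'n set" and G :: "'a set"
  assumes atomic: "\<And>X::'a. isLub UNIV {a \<in> atoms. a \<le> X} X"
    and A: "A ` I = atoms"
    and G: "decomposing G"
begin

lemma join_maximals_of_comb:
  assumes c: "\<And>x. 0 \<le> c x" and S: "nested G {x. c x \<noteq> 0}"
    and J: "isLub UNIV (maximals {x. c x \<noteq> 0}) J" and i: "i \<in> I"
  shows "A i \<le> J \<longleftrightarrow> comb (char_vec I A) c $ i \<noteq> 0"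
proof -
  let ?M = "maximals {x. c x \<noteq> 0}"
  have a: "A i \<in> atoms" using A i by blast
  have M: "nested G ?M" using S maximals_subset by (rule nested_subset)
  \<comment> \<open>The coordinate is the sum of the coefficients above \<open>A i\<close>; all are
    nonnegative, so nothing cancels.\<close>
  have "comb (char_vec I A) c $ i \<noteq> 0 \<longleftrightarrow> (\<exists>x. c x \<noteq> 0 \<and> A i \<le> x)"
    using c by (auto simp: comb_char_vec_nth [OF i] sum_nonneg_eq_0_iff)
  also have "\<dots> \<longleftrightarrow> (\<exists>x\<in>?M. A i \<le> x)"
    using le_maximals [of _ "{x. c x \<noteq> 0}"] maximals_subset [of "{x. c x \<noteq> 0}"]
    by (blast intro: order_trans)
  also have "\<dots> \<longleftrightarrow> A i \<le> J"
  proof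
    assume "\<exists>x\<in>?M. A i \<le> x"
    then show "A i \<le> J" using isLub_UNIV_upper [OF J] by (blast intro: order_trans)
  next
    assume le: "A i \<le> J"
    then have "J \<noteq> bot" using a by (auto simp: atoms_def bot.extremum_unique)
    then have "?M \<noteq> {}" using J isLub_empty_iff by metis
    then have "factors G J = ?M" using nested_factors [OF G M antichain_maximals _ J] by blast
    then show "\<exists>x\<in>?M. A i \<le> x"
      using atom_le_decomposes [OF decomposing_decomposes [OF G \<open>J \<noteq> bot\<close>] a le] by blast
  qed
  finally show ?thesis ..
qed

lemma maximals_of_comb_eq:
  assumes c: "\<And>x. 0 \<le> c x" "nested G {x. c x \<noteq> 0}"
    and d: "\<And>x. 0 \<le> d x" "nested G {x. d x \<noteq> 0}"
    and eq: "comb (char_vec I A) c = comb (char_vec I A) d"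
  shows "maximals {x. c x \<noteq> 0} = maximals {x. d x \<noteq> 0}"
proof -
  obtain J where J: "isLub UNIV (maximals {x. c x \<noteq> 0}) J"
    using nested_isLub [OF c(2) maximals_subset antichain_maximals] by blast
  obtain K where K: "isLub UNIV (maximals {x. d x \<noteq> 0}) K"
    using nested_isLub [OF d(2) maximals_subset antichain_maximals] by blast
  have "A i \<le> J \<longleftrightarrow> A i \<le> K" if "i \<in> I" for i
    using join_maximals_of_comb [OF c J that] join_maximals_of_comb [OF d K that] eq by simp
  then have "{a \<in> atoms. a \<le> J} = {a \<in> atoms. a \<le> K}"
    unfolding A [symmetric] by auto
  \<comment> \<open>By atomicity an element is determined by the atoms below it. Hence both joins
    agree, and so do their factors; the join \<open>bot\<close> is treated apart because it comes
    from the empty set.\<close>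
  then have JK: "J = K" using isLub_UNIV_unique [OF atomic [of J]] atomic [of K] by simp
  have fac: "M = factors G J" if "nested G S" "M = maximals S" "isLub UNIV M J" "J \<noteq> bot" for M S
  proof -
    have "nested G M" using nested_subset [OF that(1) maximals_subset] that(2) by simp
    moreover have "M \<noteq> {}" using that(3,4) isLub_empty_iff by metis
    ultimately show ?thesis
      using nested_factors [OF G _ _ _ that(3)] antichain_maximals [of S] that(2) by simp
  qed
  have empty: "M = {}" if "nested G S" "M = maximals S" "isLub UNIV M bot" for M S
  proof -
    have "x = bot" if "x \<in> M" for x
      using isLub_UNIV_upper [OF \<open>isLub UNIV M bot\<close> that] by (simp add: bot.extremum_unique)
    moreover have "M \<subseteq> G" using that nested_imp_subset maximals_subset by blast
    ultimately show ?thesis using G unfolding decomposing_def by blast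
  qed
  show ?thesis
  proof (cases "J = bot")
    case True
    then show ?thesis using empty [OF c(2) refl] empty [OF d(2) refl] J K JK by simp
  next
    case False
    then show ?thesis using fac [OF c(2) refl J] fac [OF d(2) refl] K JK by simp
  qed
qed

text \<open>At an atom private to \<open>X\<close> the coordinate equals \<open>c X\<close> when
  computed with \<open>c\<close>, while computed with \<open>d\<close> it is a sum containing
  \<open>d X\<close>.\<close>

lemma coefficient_le:
  assumes c: "\<And>x. 0 \<le> c x" "nested G {x. c x \<noteq> 0}" "X \<in> maximals {x. c x \<noteq> 0}"
    and d: "\<And>x. 0 \<le> d x"
    and eq: "comb (char_vec I A) c = comb (char_vec I A) d"
  shows "d X \<le> c X"
proof -
  obtain a where a: "a \<in> atoms" "\<And>Y. c Y \<noteq> 0 \<Longrightarrow> a \<le> Y \<longleftrightarrow> Y = X"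
    using private_atom [OF atomic G c(2,3)] by auto
  obtain i where i: "i \<in> I" "a = A i" using a(1) A by blast
  have X: "c X \<noteq> 0" using c(3) by (auto simp: maximals_def)
  have "d X \<le> (\<Sum>x | A i \<le> x. d x)"
    using d a(2) [OF X] i(2) by (intro member_le_sum) auto
  also have "\<dots> = (\<Sum>x | A i \<le> x. c x)"
    using eq comb_char_vec_nth [OF i(1)] by metis
  also have "\<dots> = (\<Sum>x\<in>{X}. c x)"
    by (rule sum.mono_neutral_right) (use a(2) i(2) X in auto)
  finally show ?thesis by simp
qed

lemma nested_comb_inj:
  assumes "\<And>x. 0 \<le> c x" "nested G {x. c x \<noteq> 0}" "\<And>x. 0 \<le> d x" "nested G {x. d x \<noteq> 0}"
    and "comb (char_vec I A) c = comb (char_vec I A) d"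
  shows "c = d"
  using assms
proof (induction "card {x. c x \<noteq> 0}" arbitrary: c d rule: less_induct)
  case (less c d)
  note max_eq = maximals_of_comb_eq [OF less.prems]
  show ?case
  proof (cases "{x. c x \<noteq> 0} = {}")
    case True
    then have "{x. d x \<noteq> 0} = {}"
      using max_eq le_maximals [of _ "{x. d x \<noteq> 0}"] maximals_subset [of "{x. c x \<noteq> 0}"] by blast
    then show ?thesis using True by auto
  next
    case False
    then obtain x where "x \<in> {x. c x \<noteq> 0}" by blast
    from le_maximals [OF this] obtain X where X: "X \<in> maximals {x. c x \<noteq> 0}" by blast
    have "c X \<le> d X" 
      using coefficient_le [where c = d and d = c, OF less.prems(3,4) _ less.prems(1)] X max_eq less.prems(5)
      by simp
    moreover have "d X \<le> c X" using coefficient_le [OF less.prems(1,2) X less.prems(3,5)] .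
    ultimately have cdX: "c X = d X" by simp
    let ?e = "\<lambda>y. if y = X then c X else 0"
    have cX: "c X \<noteq> 0" using X by (auto simp: maximals_def)
    \<comment> \<open>Subtracting the common term at \<open>X\<close> deletes \<open>X\<close> from
      both supports, and subsets of nested sets are nested.\<close>
    have "(\<lambda>x. c x - ?e x) = (\<lambda>x. d x - ?e x)"
    proof (rule less.hyps)
      have "{x. c x - ?e x \<noteq> 0} \<subset> {x. c x \<noteq> 0}" using cX by auto
      then show "card {x. c x - ?e x \<noteq> 0} < card {x. c x \<noteq> 0}" by (intro psubset_card_mono) auto
      show "nested G {x. c x - ?e x \<noteq> 0}" by (rule nested_subset [OF less.prems(2)]) auto
      show "nested G {x. d x - ?e x \<noteq> 0}" by (rule nested_subset [OF less.prems(4)]) (auto simp: cdX)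
      show "comb (char_vec I A) (\<lambda>x. c x - ?e x) = comb (char_vec I A) (\<lambda>x. d x - ?e x)"
        using less.prems(5) by (simp only: comb_diff)
    qed (use less.prems(1,3) cdX in auto)
    then show ?thesis by (simp add: fun_eq_iff)
  qed
qed

lemma cone_complex_nested: "cone_complex (char_vec I A) (nested_complex G)"
proof
  show "{} \<in> nested_complex G" by (auto simp: nested_complex_def nested_def)
  show "T \<in> nested_complex G" if "S \<in> nested_complex G" "T \<subseteq> S" for S T
    using that nested_subset by (auto simp: nested_complex_def)
  fix S T c d
  assume S: "S \<in> nested_complex G" "T \<in> nested_complex G"
    and c: "c \<in> nonneg_on S" "d \<in> nonneg_on T" and eq: "comb (char_vec I A) c = comb (char_vec I A) d"
  show "c = d"
  proof (rule nested_comb_inj [OF _ _ _ _ eq])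
    have "{x. c x \<noteq> 0} \<subseteq> S" "{x. d x \<noteq> 0} \<subseteq> T" using c by (auto simp: nonneg_on_def)
    then show "nested G {x. c x \<noteq> 0}" "nested G {x. d x \<noteq> 0}"
      using S nested_subset unfolding nested_complex_def by blast+
  qed (simp_all add: nonneg_onD(1) [OF c(1)] nonneg_onD(1) [OF c(2)])
qed

end


section \<open>Removing an element of a building set\<close>

context
  fixes G :: "'a::{finite,semilattice_inf,order_bot} set" and X :: 'a
  assumes G: "decomposing G" and X: "X \<in> G" and dec: "decomposes (factors (G - {X}) X) X"
begin

lemma remove_decomposing: "decomposing (G - {X})"
  using G dec by (rule decomposing_remove)

text \<open>A join of several factors stays below \<open>X\<close>; were it in
  \<open>G - {X}\<close>, maximality would make it equal to each of them. This provides the cone in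
  which to subdivide.\<close>

lemma nested_removed_factors: "nested (G - {X}) (factors (G - {X}) X)"
proof (rule nestedI)
  show "factors (G - {X}) X \<subseteq> G - {X}" using factorsD by blast
  fix T x y
  assume T: "T \<subseteq> factors (G - {X}) X" "x \<in> T" "y \<in> T" "x \<noteq> y"
  obtain J where J: "J \<le> X" "isLub UNIV T J"
    using bounded_imp_isLub [of T X] T(1) decomposes_le [OF dec] by blast
  have "J \<notin> G - {X}"
  proof
    assume "J \<in> G - {X}"
    then have "J = x" "J = y"
      using factors_maximal [of _ "G - {X}" X J] J T isLub_UNIV_upper [OF J(2)] by blast+
    then show False using T(4) by simp
  qed
  then show "\<exists>J. isLub UNIV T J \<and> J \<notin> G - {X}" using J(2) by blast
qed

lemma removed_factors_nonempty: "factors (G - {X}) X \<noteq> {}"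
proof
  assume "factors (G - {X}) X = {}"
  then have "X = bot" using decomposes_isLub [OF dec] by (simp add: isLub_empty_iff)
  then show False using X G by (simp add: decomposing_def)
qed

text \<open>A single factor would equal its join \<open>X\<close>. Having two factors makes
  nestedness apply to the whole set of factors, so no \<open>G\<close>-nested set contains
  it.\<close>

lemma removed_factors_distinct: "\<exists>x\<in>factors (G - {X}) X. \<exists>y\<in>factors (G - {X}) X. x \<noteq> y"
proof (rule ccontr)
  assume "\<not> ?thesis"
  then obtain x where x: "factors (G - {X}) X = {x}" using removed_factors_nonempty by blast
  then have "x = X"
    using decomposes_isLub [OF dec] isLub_UNIV_unique [OF isLub_singleton, of x X] by simp
  then show False using x factorsD by blast
qed

lemma nested_imp_nested_remove:
  assumes S: "nested G S" "X \<notin> S"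
  shows "nested (G - {X}) S" "\<not> factors (G - {X}) X \<subseteq> S"
proof -
  show "nested (G - {X}) S"
  proof (rule nestedI)
    show "S \<subseteq> G - {X}" using nested_imp_subset [OF S(1)] S(2) by blast
    fix T x y assume T: "T \<subseteq> S" "antichain T" "x \<in> T" "y \<in> T" "x \<noteq> y"
    obtain J where J: "isLub UNIV T J" using nested_isLub [OF S(1) T(1,2)] by blast
    then have "J \<notin> G" using nested_isLub_not_mem [OF S(1) T] by blast
    then show "\<exists>J. isLub UNIV T J \<and> J \<notin> G - {X}" using J by blast
  qed
  show "\<not> factors (G - {X}) X \<subseteq> S"
  proof
    assume sub: "factors (G - {X}) X \<subseteq> S"
    obtain x y where "x \<in> factors (G - {X}) X" "y \<in> factors (G - {X}) X" "x \<noteq> y"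
      using removed_factors_distinct by blast
    from nested_isLub_not_mem [OF S(1) sub antichain_factors this decomposes_isLub [OF dec]]
    show False using X by blast
  qed
qed

lemma nested_remove_imp_nested:
  assumes S: "nested (G - {X}) S" "\<not> factors (G - {X}) X \<subseteq> S"
  shows "nested G S"
proof (rule nestedI)
  show "S \<subseteq> G" using nested_imp_subset [OF S(1)] by blast
  fix T x y assume T: "T \<subseteq> S" "antichain T" "x \<in> T" "y \<in> T" "x \<noteq> y"
  obtain J where J: "isLub UNIV T J" using nested_isLub [OF S(1) T(1,2)] by blast
  have "J \<notin> G - {X}" using nested_isLub_not_mem [OF S(1) T J] .
  moreover have "J \<noteq> X"
  proof
    assume "J = X"
    \<comment> \<open>Only the full set of factors, among antichains of a nested set, can have join
      \<open>X\<close>.\<close>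
    then have "factors (G - {X}) X = T"
      using nested_factors [OF remove_decomposing nested_subset [OF S(1) T(1)] T(2)] J T(3) by blast
    then show False using S(2) T(1) by simp
  qed
  ultimately show "\<exists>J. isLub UNIV T J \<and> J \<notin> G" using J by blast
qed

lemma nested_insert_imp_join_nested:
  assumes S: "nested G (insert X S)" "X \<notin> S"
  shows "nested (G - {X}) (S \<union> factors (G - {X}) X)"
proof (rule nestedI)
  let ?F = "factors (G - {X}) X"
  have SG: "S \<subseteq> G - {X}" using nested_imp_subset [OF S(1)] S(2) by blast
  have S': "nested (G - {X}) S"
    using nested_imp_nested_remove(1) nested_subset [OF S(1)] S(2) by blast
  show "S \<union> ?F \<subseteq> G - {X}" using SG factorsD by blast
  fix T x y assume T: "T \<subseteq> S \<union> ?F" "antichain T" "x \<in> T" "y \<in> T" "x \<noteq> y"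
  show "\<exists>J. isLub UNIV T J \<and> J \<notin> G - {X}"
  proof (cases "T \<subseteq> S")
    case True
    then obtain J where J: "isLub UNIV T J" using nested_isLub [OF S'] T(2) by blast
    then show ?thesis using nested_isLub_not_mem [OF S' True T(2-5)] by blast
  next
    case False
    then obtain f where f: "f \<in> ?F" "f \<in> T" "f \<notin> S" using T(1) by blast
    have "f \<le> X" "f \<noteq> X" "f \<in> G" using factorsD [OF f(1)] by auto
    then have "f \<noteq> bot" using G by (auto simp: decomposing_def)
    \<comment> \<open>The part of \<open>T\<close> below \<open>X\<close> is replaced by
      \<open>X\<close> itself. The result is a \<open>G\<close>-nested antichain, so it consists of
      the factors of its join \<open>K\<close>, which bounds \<open>T\<close>.\<close>
    let ?B = "{t \<in> T. \<not> t \<le> X}"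
    have BS: "?B \<subseteq> S" using T(1) factorsD by blast
    have "\<not> X \<le> t" if "t \<in> ?B" for t
      using that antichainD [OF T(2) f(2)] \<open>f \<le> X\<close> order_trans by blast
    moreover have "antichain ?B" using T(2) by (rule pairwise_subset) auto
    ultimately have anti: "antichain (insert X ?B)" by (auto simp: pairwise_insert)
    have XB: "nested G (insert X ?B)" using BS by (intro nested_subset [OF S(1)]) auto
    obtain K where K: "isLub UNIV (insert X ?B) K" using nested_isLub [OF XB order_refl anti] by blast
    have TK: "t \<le> K" if "t \<in> T" for t
      using that isLub_UNIV_upper [OF K] by (cases "t \<le> X") (auto intro: order_trans)
    then obtain J where J: "J \<le> K" "isLub UNIV T J" using bounded_imp_isLub [of T K] by blast
    have "J \<notin> G - {X}"
    proof
      assume JG: "J \<in> G - {X}"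
      have "factors G K = insert X ?B" using nested_factors [OF G XB anti _ K] by blast
      then obtain Z where Z: "Z \<in> insert X ?B" "J \<le> Z" using le_factors [of J G K] JG J(1) by blast
      have "f \<le> Z" using isLub_UNIV_upper [OF J(2) f(2)] Z(2) by (rule order_trans)
      \<comment> \<open>The factor above \<open>J\<close> also lies above \<open>f\<close>, which is
        below \<open>X\<close> and not \<open>bot\<close>; disjointness leaves only
        \<open>X\<close>. Then \<open>J\<close> lies below a factor of \<open>X\<close>, which must
        be \<open>f\<close>, and \<open>T\<close> collapses to \<open>f\<close>.\<close>
      have "Z = X"
      proof (rule ccontr)
        assume "Z \<noteq> X"
        then have "inf X Z = bot" using nested_disjoint [OF G XB anti] Z(1) by blast
        then show False
          using \<open>f \<le> X\<close> \<open>f \<le> Z\<close> \<open>f \<noteq> bot\<close> by (metis bot.extremum_unique le_inf_iff)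
      qed
      then obtain g where g: "g \<in> ?F" "J \<le> g" using le_factors [of J "G - {X}" X] JG Z(2) by blast
      have fg: "f = g"
        using factors_maximal [OF f(1)] factorsD [OF g(1)] isLub_UNIV_upper [OF J(2) f(2)] g(2)
        by (metis order_trans)
      have "t = f" if "t \<in> T" for t
        using antichainD [OF T(2) that f(2)] isLub_UNIV_upper [OF J(2) that] g(2) fg by (metis order_trans)
      then show False using T(3-5) by blast
    qed
    then show ?thesis using J(2) by blast
  qed
qed

text \<open>For an antichain containing \<open>X\<close>, the element \<open>X\<close> is replaced
  by its factors, so that nestedness of \<open>S\<close> together with these factors applies to its
  join.\<close>

lemma join_nested_imp_nested_insert:
  assumes S: "nested (G - {X}) S" "\<not> factors (G - {X}) X \<subseteq> S"
    and SF: "nested (G - {X}) (S \<union> factors (G - {X}) X)"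
  shows "nested G (insert X S)"
proof (rule nestedI)
  let ?F = "factors (G - {X}) X"
  have SG: "nested G S" using S by (rule nested_remove_imp_nested)
  show "insert X S \<subseteq> G" using nested_imp_subset [OF SG] X by blast
  have XS: "X \<notin> S" using nested_imp_subset [OF S(1)] by blast
  fix T x y assume T: "T \<subseteq> insert X S" "antichain T" "x \<in> T" "y \<in> T" "x \<noteq> y"
  show "\<exists>J. isLub UNIV T J \<and> J \<notin> G"
  proof (cases "X \<in> T")
    case False
    then have TS: "T \<subseteq> S" using T(1) by blast
    then obtain J where "isLub UNIV T J" using nested_isLub [OF SG] T(2) by blast
    then show ?thesis using nested_isLub_not_mem [OF SG TS T(2-5)] by blast
  next
    case True
    define B where "B = T - {X}"
    have TB: "T = insert X B" and BS: "B \<subseteq> S" using True T(1) by (auto simp: B_def)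
    have incomp: "\<not> b \<le> X" "\<not> X \<le> b" if "b \<in> B" for b
      using that T(2) True by (auto simp: B_def pairwise_def)
    obtain b where b: "b \<in> B" using T(3-5) by (auto simp: B_def)
    \<comment> \<open>Factors of \<open>X\<close> below an element of \<open>B\<close> are dropped in order to obtain an antichain; its
      join is that of \<open>T\<close>.\<close>
    define C where "C = B \<union> {f \<in> ?F. \<forall>b\<in>B. \<not> f \<le> b}"
    have CSF: "C \<subseteq> S \<union> ?F" using BS by (auto simp: C_def)
    have C: "antichain C"
      unfolding C_def pairwise_def
    proof (intro ballI impI)
      fix s t assume st: "s \<in> B \<union> {f \<in> ?F. \<forall>b\<in>B. \<not> f \<le> b}" "t \<in> B \<union> {f \<in> ?F. \<forall>b\<in>B. \<not> f \<le> b}" "s \<noteq> t"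
      show "\<not> s \<le> t"
      proof
        assume le: "s \<le> t"
        then have "t \<in> B \<Longrightarrow> s \<in> B" using st(1) by blast
        moreover have "t \<in> ?F \<Longrightarrow> s \<notin> B" using le incomp(1) factorsD order_trans by blast
        moreover have "s \<in> B \<Longrightarrow> t \<notin> B"
          using le st(3) antichainD [OF T(2)] unfolding B_def by blast
        moreover have "s \<in> ?F \<Longrightarrow> t \<notin> ?F" using le st(3) antichainD [OF antichain_factors] by blast
        ultimately show False using st(1,2) by blast
      qed
    qed
    obtain K where K: "isLub UNIV C K" using nested_isLub [OF SF CSF C] by blast
    have BK: "b \<le> K" if "b \<in> B" for b using that isLub_UNIV_upper [OF K] by (simp add: C_def)
    have XK: "X \<le> K"
    proof (rule isLub_UNIV_least [OF decomposes_isLub [OF dec]])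
      fix f assume f: "f \<in> ?F"
      show "f \<le> K"
      proof (cases "\<exists>b\<in>B. f \<le> b")
        case True
        then show ?thesis using BK order_trans by blast
      next
        case False
        then show ?thesis using f isLub_UNIV_upper [OF K] by (simp add: C_def)
      qed
    qed
    have lub: "isLub UNIV T K"
    proof (rule isLub_UNIV_intro)
      fix u assume u: "\<And>s. s \<in> T \<Longrightarrow> s \<le> u"
      then have "X \<le> u" using True by blast
      then have "c \<le> u" if "c \<in> C" for c
        using that u TB factorsD [of c "G - {X}" X] order_trans unfolding C_def by blast
      then show "K \<le> u" by (rule isLub_UNIV_least [OF K])
    qed (use TB BK XK in blast)
    have "K \<noteq> X" using BK [OF b] incomp(1) [OF b] by blast
    moreover have "K \<notin> G - {X}"
    proof -
      \<comment> \<open>Nestedness excludes joins of at least two elements only. If \<open>b\<close>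
        were alone in \<open>C\<close>, then \<open>X\<close> would lie below
        \<open>b\<close>.\<close>
      have "C \<noteq> {b}"
      proof
        assume "C = {b}"
        then have "K = b" using K isLub_UNIV_unique [OF isLub_singleton, of b K] by simp
        then show False using XK incomp(2) [OF b] by blast
      qed
      then obtain c where "c \<in> C" "c \<noteq> b" using b by (auto simp: C_def)
      then show ?thesis using nested_isLub_not_mem [OF SF CSF C _ _ _ K] b by (auto simp: C_def)
    qed
    ultimately show ?thesis using lub by blast
  qed
qed

lemma nested_complex_eq:
  "nested_complex G = link_extension (nested_complex (G - {X})) (factors (G - {X}) X) X"
proof -
  let ?F = "factors (G - {X}) X"
  have "nested G S \<longleftrightarrow> (nested (G - {X}) S \<and> \<not> ?F \<subseteq> S) \<or>
    (\<exists>T. S = insert X T \<and> nested (G - {X}) T \<and> \<not> ?F \<subseteq> T \<and> nested (G - {X}) (T \<union> ?F))" for S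
  proof
    assume S: "nested G S"
    show "(nested (G - {X}) S \<and> \<not> ?F \<subseteq> S) \<or>
      (\<exists>T. S = insert X T \<and> nested (G - {X}) T \<and> \<not> ?F \<subseteq> T \<and> nested (G - {X}) (T \<union> ?F))"
    proof (cases "X \<in> S")
      case False
      then show ?thesis using nested_imp_nested_remove [OF S] by blast
    next
      case True
      then have eq: "S = insert X (S - {X})" and "nested G (S - {X})"
        using nested_subset [OF S] by auto
      then show ?thesis
        using nested_imp_nested_remove [of "S - {X}"] nested_insert_imp_join_nested [of "S - {X}"] S
        by (metis Diff_iff singletonI)
    qed
  next
    assume "(nested (G - {X}) S \<and> \<not> ?F \<subseteq> S) \<or>
      (\<exists>T. S = insert X T \<and> nested (G - {X}) T \<and> \<not> ?F \<subseteq> T \<and> nested (G - {X}) (T \<union> ?F))"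
    then show "nested G S"
      using nested_remove_imp_nested join_nested_imp_nested_insert by blast
  qed
  then show ?thesis by (auto simp: nested_complex_def link_extension_def)
qed

end

section \<open>From a single removal to the whole sequence of subdivisions\<close>

lemma nested_fan_remove:
  fixes A :: "'n::finite \<Rightarrow> 'a::{finite,semilattice_inf,order_bot}"
  assumes atomic: "\<And>X::'a. isLub UNIV {a \<in> atoms. a \<le> X} X" and A: "A ` I = atoms"
    and G: "decomposing G" and X: "X \<in> G" and dec: "decomposes (factors (G - {X}) X) X"
  shows "stellar_subdivision (nested_fan I A (G - {X})) (nested_fan I A G)"
    and "\<Union>(nested_fan I A G) = \<Union>(nested_fan I A (G - {X}))"
proof -
  interpret cone_complex "char_vec I A" "nested_complex (G - {X})"
    using atomic A remove_decomposing [OF G X dec] by (rule cone_complex_nested)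
  have fan: "nested_fan I A K = vcone ` nested_complex K" for K
    by (simp add: nested_fan_def cone_of_def vcone_def)
  have F: "factors (G - {X}) X \<in> nested_complex (G - {X})"
    using nested_removed_factors [OF G X dec] by (simp add: nested_complex_def)
  have vec: "char_vec I A X = sum (char_vec I A) (factors (G - {X}) X)"
    using char_vec_decomposes [OF dec] A by blast
  note star = nested_complex_eq [OF G X dec]
  show "stellar_subdivision (nested_fan I A (G - {X})) (nested_fan I A G)"
    unfolding fan star
    by (rule stellar_subdivision_link_extension [OF F removed_factors_nonempty [OF G X dec] vec])
  show "\<Union>(nested_fan I A G) = \<Union>(nested_fan I A (G - {X}))"
    unfolding fan star
    by (rule Union_link_extension [OF F removed_factors_nonempty [OF G X dec] vec])
qed

lemma nested_fan_subdivision: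
  fixes A :: "'n::finite \<Rightarrow> 'a::{finite,semilattice_inf,order_bot}"
  assumes atomic: "\<And>X::'a. isLub UNIV {a \<in> atoms. a \<le> X} X" and A: "A ` I = atoms"
    and H: "decomposing H" and G: "decomposing G" "H \<subseteq> G"
  shows "stellar_subdivision\<^sup>*\<^sup>* (nested_fan I A H) (nested_fan I A G) \<and>
    \<Union>(nested_fan I A G) = \<Union>(nested_fan I A H)"
  using G
proof (induction "card (G - H)" arbitrary: G rule: less_induct)
  case (less G)
  show ?case
  proof (cases "G = H")
    case True
    then show ?thesis by simp
  next
    case False
    then have "G - H \<noteq> {}" using less.prems by blast
    then obtain X where X: "X \<in> G - H" and min: "\<And>Y. Y \<in> G - H \<Longrightarrow> Y \<le> X \<Longrightarrow> Y = X"
      using finite_has_minimal [of "G - H"] by auto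
    \<comment> \<open>Minimality of \<open>X\<close> lets its decomposition be taken from
      \<open>H\<close>.\<close>
    have "{Y \<in> G - {X}. Y \<le> X} = {Y \<in> H. Y \<le> X}" using X min less.prems(2) by blast
    then have "factors (G - {X}) X = factors H X" by (simp add: factors_def)
    moreover have "X \<noteq> bot" using X less.prems(1) by (auto simp: decomposing_def)
    ultimately have dec: "decomposes (factors (G - {X}) X) X"
      using decomposing_decomposes [OF H] by simp
    have XG: "X \<in> G" using X by blast
    have "card (G - {X} - H) < card (G - H)" using X by (intro psubset_card_mono) auto
    then have "stellar_subdivision\<^sup>*\<^sup>* (nested_fan I A H) (nested_fan I A (G - {X})) \<and>
      \<Union>(nested_fan I A (G - {X})) = \<Union>(nested_fan I A H)"
      by (rule less.hyps [OF _ decomposing_remove [OF less.prems(1) dec]])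
         (use X less.prems(2) in blast)
    then show ?thesis
      using nested_fan_remove [OF atomic A less.prems(1) XG dec] by (auto intro: rtranclp.rtrancl_into_rtrancl)
  qed
qed

theorem theorem4p2:
  fixes G H :: "'a::{finite,semilattice_inf,order_bot} set"
    and I :: "'n::finite set"
    and A :: "'n \<Rightarrow> 'a"
  assumes atomic: "\<forall>X::'a. isLub UNIV {a \<in> atoms. a \<le> X} X"
    and enum: "bij_betw A I atoms"
    and "building_set G"
    and "building_set H"
    and "H \<subseteq> G"
  shows "stellar_subdivision\<^sup>*\<^sup>* (nested_fan I A H) (nested_fan I A G) \<and>
    \<Union>(nested_fan I A G) = \<Union>(nested_fan I A H)"
  using assms by (intro nested_fan_subdivision building_set_decomposing) (auto simp: bij_betw_def)

end
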